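(* There exists a one-parameter family $\mathcal{M}=\{g_\delta\}_{\delta\in I}$ (with $I\subset\mathbb{R}$ an interval of parameters) of smooth $S^1$-invariant Riemannian metrics on the unit disc, each with positive Gaussian curvature and total area $\pi$, such that the following hold. (i) Given any positive integer $m$ and any real number $\varepsilon>0$, there exists a subset $\mathcal{M}_\varepsilon=\mathcal{M}_{\varepsilon}(m)$ of $\mathcal{M}$, corresponding to the parameter $\delta$ ranging over a nonempty open interval, such that for every metric in $\mathcal{M}_\varepsilon$ the first $m$ $S^1$-invariant eigenvalues of the Laplace operator, both with Neumann and with Dirichlet boundary conditions, are smaller than $\varepsilon$. (ii) The non-invariant spectrum (for both boundary conditions) remains uniformly bounded away from zero in $\mathcal{M}$: there is a constant $c>0$ such that, for every metric in $\mathcal{M}$, every non-invariant eigenvalue is at least $c$. (iii) The non-invariant spectrum (for both boundary conditions) becomes arbitrarily large in $\mathcal{M}_\varepsilon$ as $\varepsilon\to 0$: for every $m$ and every $R>0$ there is $\varepsilon_0>0$ such that for all $0<\varepsilon<\varepsilon_0$ and every metric in $\mathcal{M}_\varepsilon$, all non-invariant eigenvalues are larger than $R$.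
   Context: Let $D\subset\mathbb{R}^2$ be the unit disc centred at the origin, on which $S^1$ acts by rotations about the origin. A metric on $D$ is $S^1$-invariant if it is invariant under this action. For a Riemannian metric $g$ on $D$ with Laplace-Beltrami operator $\Delta_g$, the eigenvalues with Dirichlet (respectively Neumann) boundary conditions are the numbers $\gamma$ for which $\Delta_g u+\gamma u=0$ in $D$ has a nonzero solution with $u=0$ (respectively $\partial u/\partial\nu=0$, $\nu$ the conormal direction) on $\partial D$; they are listed in increasing order. In the Neumann case the first eigenvalue is $0$. For an $S^1$-invariant metric the spectrum splits into two parts. The $S^1$-invariant eigenvalues are the eigenvalues of $\Delta_g$ (with the given boundary condition) acting on $S^1$-invariant (i.e. radially symmetric) functions, listed in increasing order. The non-invariant spectrum is the remaining part: in polar coordinates $(r,\theta)$, it consists of the eigenvalues having eigenfunctions of the form $\varphi(r)\cos(k\theta)$ and $\varphi(r)\sin(k\theta)$ with $k\geq 1$ an integer. *)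

theory Defs
  imports "HOL-Analysis.Analysis"
begin

section \<open>Smooth functions on the closed unit disc\<close>

type_synonym plane = "real^2"

text \<open>
  The closed unit disc is \<open>cball 0 1\<close>. Tensors and functions on it are represented by total
  functions on the plane that are smooth in some neighbourhood of the closed disc, so that
  partial derivatives at boundary points are the usual ones; the values away from the closed
  disc carry no information.
\<close>

definition partial :: "2 \<Rightarrow> (plane \<Rightarrow> real) \<Rightarrow> plane \<Rightarrow> real" where
  "partial i f x = frechet_derivative f (at x) (axis i 1)"

text \<open>Only meaningful for open \<open>U\<close>.\<close>

primrec Ck_on :: "nat \<Rightarrow> (plane \<Rightarrow> real) \<Rightarrow> plane set \<Rightarrow> bool" where
  "Ck_on 0 f U \<longleftrightarrow> continuous_on U f"
| "Ck_on (Suc k) f U \<longleftrightarrow> (\<forall>x\<in>U. f differentiable (at x)) \<and> (\<forall>i. Ck_on k (partial i f) U)"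

definition smooth_on_disc :: "(plane \<Rightarrow> real) \<Rightarrow> bool" where
  "smooth_on_disc f \<longleftrightarrow> (\<exists>U. open U \<and> cball 0 1 \<subseteq> U \<and> (\<forall>k. Ck_on k f U))"

definition polar :: "real \<Rightarrow> real \<Rightarrow> plane" where
  "polar r t = vector [r * cos t, r * sin t]"

definition rotation :: "real \<Rightarrow> real^2^2" where
  "rotation t = vector [vector [cos t, - sin t], vector [sin t, cos t]]"


section \<open>Riemannian metrics on the disc\<close>

text \<open>\<open>g x $ i $ j\<close> is the coefficient of \<open>dx\<^sub>i dx\<^sub>j\<close> at \<open>x\<close> in Cartesian coordinates.\<close>

type_synonym metric = "plane \<Rightarrow> real^2^2"

definition riemannian_metric :: "metric \<Rightarrow> bool" where
  "riemannian_metric g \<longleftrightarrow>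
     (\<forall>i j. smooth_on_disc (\<lambda>x. g x $ i $ j)) \<and>
     (\<forall>x\<in>cball 0 1. transpose (g x) = g x \<and> (\<forall>v. v \<noteq> 0 \<longrightarrow> v \<bullet> (g x *v v) > 0))"

text \<open>Invariance under pullback by all rotations about the origin.\<close>

definition S1_invariant_metric :: "metric \<Rightarrow> bool" where
  "S1_invariant_metric g \<longleftrightarrow>
     (\<forall>t. \<forall>x\<in>cball 0 1.
        transpose (rotation t) ** g (rotation t *v x) ** rotation t = g x)"

definition has_area :: "metric \<Rightarrow> real \<Rightarrow> bool" where
  "has_area g A \<longleftrightarrow> ((\<lambda>x. sqrt (det (g x))) has_integral A) (cball 0 1)"

text \<open>\<open>christoffel g k i j\<close> has upper index \<open>k\<close>: the coefficients of the Levi-Civita connection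
  are given by \<open>\<nabla>\<^sub>i \<partial>\<^sub>j = (\<Sum>k. christoffel g k i j \<partial>\<^sub>k)\<close>.\<close>

definition christoffel :: "metric \<Rightarrow> 2 \<Rightarrow> 2 \<Rightarrow> 2 \<Rightarrow> plane \<Rightarrow> real" where
  "christoffel g k i j x =
     (\<Sum>l\<in>UNIV. matrix_inv (g x) $ k $ l *
        (partial i (\<lambda>y. g y $ j $ l) x + partial j (\<lambda>y. g y $ i $ l) x
          - partial l (\<lambda>y. g y $ i $ j) x)) / 2"

text \<open>The \<open>\<partial>\<^sub>l\<close>-component of
  \<open>R(\<partial>\<^sub>i, \<partial>\<^sub>j) \<partial>\<^sub>k = \<nabla>\<^sub>i \<nabla>\<^sub>j \<partial>\<^sub>k - \<nabla>\<^sub>j \<nabla>\<^sub>i \<partial>\<^sub>k\<close>.\<close>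

definition riemann :: "metric \<Rightarrow> 2 \<Rightarrow> 2 \<Rightarrow> 2 \<Rightarrow> 2 \<Rightarrow> plane \<Rightarrow> real" where
  "riemann g l i j k x =
     partial i (christoffel g l j k) x - partial j (christoffel g l i k) x
     + (\<Sum>m\<in>UNIV. christoffel g l i m x * christoffel g m j k x
                   - christoffel g l j m x * christoffel g m i k x)"

text \<open>The sectional curvature \<open>g(R(\<partial>\<^sub>1, \<partial>\<^sub>2) \<partial>\<^sub>2, \<partial>\<^sub>1) / det g\<close> of the tangent plane.\<close>

definition gauss_curvature :: "metric \<Rightarrow> plane \<Rightarrow> real" where
  "gauss_curvature g x = (\<Sum>l\<in>UNIV. g x $ 1 $ l * riemann g l 1 2 2 x) / det (g x)"

definition laplace_beltrami :: "metric \<Rightarrow> (plane \<Rightarrow> real) \<Rightarrow> plane \<Rightarrow> real" where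
  "laplace_beltrami g u x =
     (\<Sum>i\<in>UNIV. partial i
        (\<lambda>y. sqrt (det (g y)) * (\<Sum>j\<in>UNIV. matrix_inv (g y) $ i $ j * partial j u y)) x)
     / sqrt (det (g x))"

text \<open>At a boundary point \<open>x\<close> the Euclidean outward unit normal is \<open>x\<close> itself, and the conormal
  direction of \<open>g\<close> is the vector \<open>matrix_inv (g x) *v x\<close>.\<close>

definition conormal_derivative :: "metric \<Rightarrow> (plane \<Rightarrow> real) \<Rightarrow> plane \<Rightarrow> real" where
  "conormal_derivative g u x = (\<Sum>i\<in>UNIV. (matrix_inv (g x) *v x) $ i * partial i u x)"


section \<open>The Dirichlet and Neumann spectra\<close>

datatype boundary_condition = Dirichlet | Neumann

fun satisfies_bc :: "boundary_condition \<Rightarrow> metric \<Rightarrow> (plane \<Rightarrow> real) \<Rightarrow> bool" where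
  "satisfies_bc Dirichlet g u \<longleftrightarrow> (\<forall>x\<in>sphere 0 1. u x = 0)"
| "satisfies_bc Neumann g u \<longleftrightarrow> (\<forall>x\<in>sphere 0 1. conormal_derivative g u x = 0)"

definition eigenfunction ::
    "boundary_condition \<Rightarrow> metric \<Rightarrow> real \<Rightarrow> (plane \<Rightarrow> real) \<Rightarrow> bool" where
  "eigenfunction bc g \<gamma> u \<longleftrightarrow>
     smooth_on_disc u \<and> (\<exists>x\<in>cball 0 1. u x \<noteq> 0) \<and>
     (\<forall>x\<in>ball 0 1. laplace_beltrami g u x + \<gamma> * u x = 0) \<and>
     satisfies_bc bc g u"

definition S1_invariant_function :: "(plane \<Rightarrow> real) \<Rightarrow> bool" where
  "S1_invariant_function u \<longleftrightarrow> (\<forall>t. \<forall>x\<in>cball 0 1. u (rotation t *v x) = u x)"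

definition invariant_spectrum :: "boundary_condition \<Rightarrow> metric \<Rightarrow> real set" where
  "invariant_spectrum bc g =
     {\<gamma>. \<exists>u. eigenfunction bc g \<gamma> u \<and> S1_invariant_function u}"

definition noninvariant_spectrum :: "boundary_condition \<Rightarrow> metric \<Rightarrow> real set" where
  "noninvariant_spectrum bc g =
     {\<gamma>. \<exists>k::nat. \<exists>\<phi> u v. k \<ge> 1 \<and>
        eigenfunction bc g \<gamma> u \<and> eigenfunction bc g \<gamma> v \<and>
        (\<forall>r\<in>{0..1}. \<forall>t. u (polar r t) = \<phi> r * cos (real k * t) \<and>
                         v (polar r t) = \<phi> r * sin (real k * t))}"

text \<open>
  \<open>x\<close> has index \<open>n\<close>, counted from 0, in the increasing listing of \<open>S\<close>. For an invariant
  spectrum the listing by distinct values is also the listing with multiplicity: the radial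
  equation has, up to scaling, only one solution that is regular at the origin.
\<close>

definition nth_in_order :: "real set \<Rightarrow> nat \<Rightarrow> real \<Rightarrow> bool" where
  "nth_in_order S n x \<longleftrightarrow> x \<in> S \<and> finite {y\<in>S. y < x} \<and> card {y\<in>S. y < x} = n"

end

theory Submission
  imports Defs
begin

text \<open>
  In symplectic coordinates an \<open>S\<^sup>1\<close>-invariant metric of area \<open>\<pi>\<close> on the disc is
  \<open>dx\<^sup>2 / f + f d\<theta>\<^sup>2\<close> on \<open>0 \<le> x \<le> 1/2\<close>, with curvature \<open>- f'' / 2\<close>. On the functions
  \<open>\<phi>(x) cos(k \<theta>)\<close> the eigenvalue equation reads \<open>(f \<phi>')' - k\<^sup>2 \<phi> / f + \<gamma> \<phi> = 0\<close>, so a small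
  \<open>f\<close> makes the eigenvalues large for \<open>k \<ge> 1\<close> and small for \<open>k = 0\<close>. We take
  \<open>f = 2 x / (1 + 2 b x)\<close> with \<open>b \<rightarrow> \<infinity>\<close> and let \<open>r\<close> with \<open>r\<^sup>2 = s = 2 x\<close> be the Cartesian
  radius, for which the metric is rational with determinant 1. For \<open>k = 0\<close> the flux \<open>v\<close> of an eigenfunction
  satisfies \<open>s v'' + (\<gamma> / 4) (1 + b s) v = 0\<close>, whose regular solution is entire; the rotation of
  the vector \<open>(v', \<kappa> v)\<close> over \<open>0 \<le> s \<le> 1\<close> varies continuously with \<open>\<gamma>\<close>, from less than \<open>\<pi>/2\<close>
  at \<open>\<gamma> = 0\<close> to at least \<open>\<kappa>\<close> when \<open>\<gamma> b = 4 \<kappa>\<^sup>2\<close>, and each passage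
  through a positive multiple of \<open>\<pi>/2\<close> yields an eigenvalue of one of the two boundary problems.
\<close>

section \<open>Gradients and smoothness in the plane\<close>

lemma axis_2_nth [simp]:
  "axis (1::2) (1::real) $ 1 = 1" "axis (1::2) (1::real) $ 2 = 0"
  "axis (2::2) (1::real) $ 1 = 0" "axis (2::2) (1::real) $ 2 = 1"
  by (simp_all add: axis_def)

text \<open>\<open>partial\<close> is a total function with a meaningless value where
  \<open>f\<close> is not differentiable. Keeping differentiability and both components in one
  predicate turns later computations of partial derivatives into rule application followed by
  algebra.\<close>

definition has_grad :: "(plane \<Rightarrow> real) \<Rightarrow> real \<Rightarrow> real \<Rightarrow> plane \<Rightarrow> bool" where
  "has_grad f a c x \<longleftrightarrow> (f has_derivative (\<lambda>h. a * h $ 1 + c * h $ 2)) (at x)"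

lemma has_grad_partial:
  assumes "has_grad f a c x"
  shows "partial 1 f x = a" "partial 2 f x = c"
  using assms unfolding has_grad_def partial_def
  by (simp_all add: frechet_derivative_at[symmetric])

lemma has_grad_eq: "has_grad f a c x \<Longrightarrow> a = a' \<Longrightarrow> c = c' \<Longrightarrow> has_grad f a' c' x"
  by simp

lemma has_grad_differentiable: "has_grad f a c x \<Longrightarrow> f differentiable (at x)"
  unfolding has_grad_def differentiable_def by blast

lemma differentiable_has_grad:
  assumes "f differentiable (at x)"
  shows "has_grad f (partial 1 f x) (partial 2 f x) x"
proof -
  let ?F = "frechet_derivative f (at x)"
  have d: "(f has_derivative ?F) (at x)"
    using assms by (simp add: frechet_derivative_works)
  then interpret F: bounded_linear ?F by (rule has_derivative_bounded_linear)
  have "?F h = partial 1 f x * h $ 1 + partial 2 f x * h $ 2" for h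
  proof -
    have h: "h = (h $ 1) *\<^sub>R axis 1 1 + (h $ 2) *\<^sub>R axis 2 1"
      by (simp add: vec_eq_iff forall_2)
    have "?F h = ?F ((h $ 1) *\<^sub>R axis 1 1 + (h $ 2) *\<^sub>R axis 2 1)"
      using h by simp
    then show ?thesis by (simp add: F.add F.scaleR partial_def)
  qed
  then have "?F = (\<lambda>h. partial 1 f x * h $ 1 + partial 2 f x * h $ 2)" by blast
  with d show ?thesis by (simp add: has_grad_def)
qed

lemma has_grad_const: "has_grad (\<lambda>_. k) 0 0 x"
  unfolding has_grad_def by simp

lemma has_grad_coord: "has_grad (\<lambda>x. x $ 1) 1 0 x" "has_grad (\<lambda>x. x $ 2) 0 1 x"
  unfolding has_grad_def
  by (auto intro!: derivative_eq_intros bounded_linear.has_derivative[OF bounded_linear_vec_nth])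

lemma has_grad_add:
  "has_grad f a c x \<Longrightarrow> has_grad g a' c' x \<Longrightarrow> has_grad (\<lambda>y. f y + g y) (a + a') (c + c') x"
  unfolding has_grad_def by (auto intro!: derivative_eq_intros simp: algebra_simps)

lemma has_grad_diff:
  "has_grad f a c x \<Longrightarrow> has_grad g a' c' x \<Longrightarrow> has_grad (\<lambda>y. f y - g y) (a - a') (c - c') x"
  unfolding has_grad_def by (auto intro!: derivative_eq_intros simp: algebra_simps)

lemma has_grad_mult:
  "has_grad f a c x \<Longrightarrow> has_grad g a' c' x \<Longrightarrow>
    has_grad (\<lambda>y. f y * g y) (f x * a' + a * g x) (f x * c' + c * g x) x"
  unfolding has_grad_def by (auto intro!: derivative_eq_intros simp: algebra_simps)

lemma has_grad_chain:
  assumes "has_grad p a c x" "(f has_real_derivative D) (at (p x))"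
  shows "has_grad (\<lambda>y. f (p y)) (D * a) (D * c) x"
proof -
  have "((\<lambda>y. f (p y)) has_derivative (\<lambda>h. D * (a * h $ 1 + c * h $ 2))) (at x)"
    using has_derivative_compose[OF assms(1)[unfolded has_grad_def]
        assms(2)[unfolded has_field_derivative_def]] by simp
  then show ?thesis unfolding has_grad_def by (simp add: algebra_simps)
qed

lemmas has_grad_intros = has_grad_const has_grad_coord has_grad_add has_grad_diff has_grad_mult

section \<open>Closure properties of \<open>Ck_on\<close>\<close>

lemma Ck_on_SucD: "Ck_on (Suc k) f U \<Longrightarrow> Ck_on k f U"
proof (induction k arbitrary: f)
  case 0
  then have "f differentiable_on U"
    by (auto simp: differentiable_on_def intro: differentiable_at_withinI)
  then show ?case by (simp add: differentiable_imp_continuous_on)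
next
  case (Suc k)
  then show ?case by (metis Ck_on.simps(2))
qed

text \<open>The sum, product and chain rules determine \<open>partial i\<close> only on
  \<open>U\<close>, so the inductions on \<open>k\<close> below must replace a function by one that
  agrees with it on \<open>U\<close>. On an open set the derivatives depend only on the values
  there.\<close>

lemma Ck_on_cong:
  assumes "open U" "\<And>x. x \<in> U \<Longrightarrow> f x = g x" "Ck_on k f U"
  shows "Ck_on k g U"
  using assms(2,3)
proof (induction k arbitrary: f g)
  case 0
  then show ?case by (simp cong: continuous_on_cong)
next
  case (Suc k)
  have ev: "\<forall>\<^sub>F y in nhds x. f y = g y" if "x \<in> U" for x
    using eventually_nhds assms(1) Suc.prems(1) that by blast
  have d: "(f has_derivative D) (at x) \<longleftrightarrow> (g has_derivative D) (at x)" if "x \<in> U" for D x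
    using has_derivative_transform_within_open[OF _ assms(1) that] Suc.prems(1)
    by (metis (no_types, lifting))
  have "partial i f x = partial i g x" if "x \<in> U" for i x
    unfolding partial_def frechet_derivative_def using d[OF that] by simp
  moreover have "g differentiable (at x)" if "x \<in> U" for x
    using Suc.prems(2) d that by (auto simp: differentiable_def)
  moreover have "Ck_on k (partial i g) U" for i
    by (rule Suc.IH[of "partial i f"]) (simp_all add: calculation(1) Suc.prems(2)[simplified])
  ultimately show ?case by simp
qed

lemma Ck_on_const: "Ck_on k (\<lambda>_. c) U"
proof (induction k arbitrary: c)
  case (Suc k)
  have "partial i (\<lambda>_. c) = (\<lambda>_. 0)" for i
    using exhaust_2[of i] by (auto intro!: ext simp: has_grad_partial[OF has_grad_const])
  then show ?case using Suc by simp
qed simp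

lemma Ck_on_coord: "Ck_on k (\<lambda>x. x $ i) U"
proof (cases k)
  case (Suc n)
  have "\<exists>c. partial j (\<lambda>x. x $ i) = (\<lambda>_. c)" for j
    using exhaust_2[of i] exhaust_2[of j]
    by (auto intro!: ext simp: has_grad_partial[OF has_grad_coord(1)]
        has_grad_partial[OF has_grad_coord(2)])
  then have "Ck_on n (partial j (\<lambda>x. x $ i)) U" for j
    by (metis Ck_on_const)
  moreover have "(\<lambda>x::plane. x $ i) differentiable (at x)" for x
    by (simp add: bounded_linear_imp_differentiable bounded_linear_vec_nth)
  ultimately show ?thesis using Suc by simp
qed (auto intro!: continuous_intros)

lemma Ck_on_add:
  assumes "open U"
  shows "Ck_on k f U \<Longrightarrow> Ck_on k g U \<Longrightarrow> Ck_on k (\<lambda>x. f x + g x) U"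
proof (induction k arbitrary: f g)
  case (Suc k)
  have "partial i f x + partial i g x = partial i (\<lambda>x. f x + g x) x" if "x \<in> U" for i x
  proof -
    have "f differentiable (at x)" "g differentiable (at x)" using Suc.prems that by auto
    from has_grad_partial[OF has_grad_add[OF this[THEN differentiable_has_grad]]] exhaust_2[of i]
    show ?thesis by (elim disjE) simp_all
  qed
  note eq = this
  have "Ck_on k (partial i (\<lambda>x. f x + g x)) U" for i
    using Suc.prems by (intro Ck_on_cong[OF assms eq] Suc.IH) simp_all
  then show ?case using Suc.prems by (auto intro: differentiable_add)
qed (auto intro!: continuous_intros)

lemma Ck_on_mult:
  assumes "open U"
  shows "Ck_on k f U \<Longrightarrow> Ck_on k g U \<Longrightarrow> Ck_on k (\<lambda>x. f x * g x) U"
proof (induction k arbitrary: f g)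
  case (Suc k)
  have "f x * partial i g x + partial i f x * g x = partial i (\<lambda>x. f x * g x) x"
    if "x \<in> U" for i x
  proof -
    have "f differentiable (at x)" "g differentiable (at x)" using Suc.prems that by auto
    from has_grad_partial[OF has_grad_mult[OF this[THEN differentiable_has_grad]]] exhaust_2[of i]
    show ?thesis by (elim disjE) simp_all
  qed
  note eq = this
  have "Ck_on k f U" "Ck_on k g U"
    using Suc.prems by (auto intro: Ck_on_SucD simp del: Ck_on.simps)
  then have "Ck_on k (partial i (\<lambda>x. f x * g x)) U" for i
    using Suc.prems by (intro Ck_on_cong[OF assms eq] Ck_on_add[OF assms] Suc.IH) simp_all
  then show ?case using Suc.prems by (auto intro: differentiable_mult)
qed (auto intro!: continuous_intros)

text \<open>The whole sequence of successive derivatives is carried along so that the induction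
  closes: differentiating \<open>F n\<close> composed with \<open>p\<close> produces
  \<open>F (Suc n)\<close> composed with \<open>p\<close>, which the induction hypothesis
  covers.\<close>

lemma Ck_on_chain:
  assumes "open U" "\<And>n t. (F n has_real_derivative F (Suc n) t) (at t)" "\<And>k. Ck_on k p U"
  shows "Ck_on k (\<lambda>x. F n (p x)) U"
proof (induction k arbitrary: n)
  case 0
  have "continuous_on UNIV (F n)"
    by (meson DERIV_continuous_on assms(2) DERIV_subset top_greatest)
  then show ?case
    using assms(3)[of 0] by (auto intro: continuous_on_compose2)
next
  case (Suc k)
  have d: "has_grad (\<lambda>x. F n (p x)) (F (Suc n) (p x) * partial 1 p x)
      (F (Suc n) (p x) * partial 2 p x) x" if "x \<in> U" for x
    using assms(3)[of 1] that by (intro has_grad_chain assms(2) differentiable_has_grad) auto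
  have "F (Suc n) (p x) * partial i p x = partial i (\<lambda>x. F n (p x)) x" if "x \<in> U" for i x
    using has_grad_partial[OF d[OF that]] exhaust_2[of i] by (elim disjE) simp_all
  note eq = this
  have "Ck_on k (partial i (\<lambda>x. F n (p x))) U" for i
    using assms(3)[of "Suc k"]
    by (intro Ck_on_cong[OF assms(1) eq] Ck_on_mult[OF assms(1)] Suc.IH) simp_all
  then show ?case using has_grad_differentiable[OF d] by simp
qed


section \<open>The metrics\<close>

text \<open>With \<open>s = x\<^sub>1\<^sup>2 + x\<^sub>2\<^sup>2\<close>, the metric below equals \<open>\<sigma>\<close> on tangential and \<open>1 / \<sigma>\<close> on radial
  vectors, where \<open>\<sigma> = 1 / (1 + b s)\<close>; in particular its determinant is 1.\<close>

definition sig :: "real \<Rightarrow> plane \<Rightarrow> real" where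
  "sig b x = 1 / (1 + b * (x $ 1 * x $ 1 + x $ 2 * x $ 2))"

definition cigar :: "real \<Rightarrow> metric" where
  "cigar b x = vector
     [vector [sig b x + b * (1 + sig b x) * (x $ 1 * x $ 1), b * (1 + sig b x) * (x $ 1 * x $ 2)],
      vector [b * (1 + sig b x) * (x $ 1 * x $ 2), sig b x + b * (1 + sig b x) * (x $ 2 * x $ 2)]]"

text \<open>The adjugate of \<open>cigar b x\<close>, hence its inverse because the determinant is
  1.\<close>

definition cigar_inv :: "real \<Rightarrow> metric" where
  "cigar_inv b x = vector
     [vector [sig b x + b * (1 + sig b x) * (x $ 2 * x $ 2), - (b * (1 + sig b x) * (x $ 1 * x $ 2))],
      vector [- (b * (1 + sig b x) * (x $ 1 * x $ 2)), sig b x + b * (1 + sig b x) * (x $ 1 * x $ 1)]]"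

context
  fixes b :: real
  assumes b: "b > 0"
begin

lemma sig_denom_pos: "1 + b * (x * x + y * y) > (0::real)"
  using b by (metis add_pos_nonneg less_eq_real_def mult_nonneg_nonneg sum_squares_ge_zero zero_less_one)

lemma sig_pos: "sig b x > 0"
  using sig_denom_pos by (simp add: sig_def)

text \<open>The metric, its gradient, the Christoffel symbols and the curvature are polynomials in
  \<open>b\<close>, the coordinates and \<open>sig b x\<close>, so the tensor identities below
  reduce to polynomial algebra modulo this relation.\<close>

lemma sig_eq: "sig b x * (1 + b * (x $ 1 * x $ 1 + x $ 2 * x $ 2)) = 1"
  using sig_denom_pos[of "x $ 1" "x $ 2"] by (simp add: sig_def)

lemma has_grad_sig:
  "has_grad (sig b) (- 2 * b * (x $ 1) * (sig b x * sig b x)) (- 2 * b * (x $ 2) * (sig b x * sig b x)) x"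
proof -
  let ?D = "\<lambda>x. 1 + b * (x $ 1 * x $ 1 + x $ 2 * x $ 2)"
  have "has_grad ?D (2 * b * x $ 1) (2 * b * x $ 2) x"
    by (rule has_grad_eq, (rule has_grad_intros)+) simp_all
  moreover have "((\<lambda>t. 1 / t) has_real_derivative - (sig b x * sig b x)) (at (?D x))"
    using sig_denom_pos[of "x $ 1" "x $ 2"]
    by (auto intro!: derivative_eq_intros simp: sig_def)
  ultimately have "has_grad (\<lambda>x. 1 / ?D x) (- (sig b x * sig b x) * (2 * b * x $ 1))
    (- (sig b x * sig b x) * (2 * b * x $ 2)) x"
    by (rule has_grad_chain)
  then have "has_grad (sig b) (- (sig b x * sig b x) * (2 * b * x $ 1))
    (- (sig b x * sig b x) * (2 * b * x $ 2)) x"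
    unfolding sig_def[abs_def] .
  then show ?thesis by (rule has_grad_eq) simp_all
qed

lemma det_cigar: "det (cigar b x) = 1"
  using sig_eq[of x] unfolding cigar_def det_2 vector_2 by algebra

lemma matrix_inv_cigar: "matrix_inv (cigar b x) = cigar_inv b x"
proof -
  have mult: "cigar b x ** cigar_inv b x = mat 1" "cigar_inv b x ** cigar b x = mat 1"
    using sig_eq[of x]
    unfolding vec_eq_iff forall_2 matrix_matrix_mult_def mat_def cigar_def cigar_inv_def
    by (simp_all add: sum_2) algebra+
  then have "cigar b x ** matrix_inv (cigar b x) = mat 1"
    unfolding matrix_inv_def by (metis (mono_tags, lifting) someI_ex)
  then show ?thesis
    using mult(2) by (metis matrix_mul_assoc matrix_mul_lid matrix_mul_rid)
qed

lemma has_grad_cigar: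
  defines "A \<equiv> sig b"
  shows "has_grad (\<lambda>x. cigar b x $ 1 $ 1)
      (2 * b * x $ 1 * (1 + A x) - 2 * b * x $ 1 * (A x * A x) * (1 + b * (x $ 1 * x $ 1)))
      (- 2 * b * x $ 2 * (A x * A x) * (1 + b * (x $ 1 * x $ 1))) x"
    and "has_grad (\<lambda>x. cigar b x $ 1 $ 2)
      (b * x $ 2 * (1 + A x - 2 * b * (x $ 1 * x $ 1) * (A x * A x)))
      (b * x $ 1 * (1 + A x - 2 * b * (x $ 2 * x $ 2) * (A x * A x))) x"
    and "has_grad (\<lambda>x. cigar b x $ 2 $ 1)
      (b * x $ 2 * (1 + A x - 2 * b * (x $ 1 * x $ 1) * (A x * A x)))
      (b * x $ 1 * (1 + A x - 2 * b * (x $ 2 * x $ 2) * (A x * A x))) x"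
    and "has_grad (\<lambda>x. cigar b x $ 2 $ 2)
      (- 2 * b * x $ 1 * (A x * A x) * (1 + b * (x $ 2 * x $ 2)))
      (2 * b * x $ 2 * (1 + A x) - 2 * b * x $ 2 * (A x * A x) * (1 + b * (x $ 2 * x $ 2))) x"
  unfolding cigar_def vector_2 A_def
  by (rule has_grad_eq, (rule has_grad_intros has_grad_sig)+; (simp; algebra))+

section \<open>Levi-Civita connection and Gauss curvature\<close>

lemma christoffel_cigar:
  fixes x :: plane
  defines "A \<equiv> sig b x" and "B \<equiv> b * sig b x * (1 + sig b x + sig b x * sig b x)"
    and "C \<equiv> b * b * sig b x * sig b x * (2 + sig b x)"
  shows "christoffel (cigar b) 1 1 1 x = (B - 2 * b * A) * x $ 1 + C * (x $ 1 * x $ 1 * x $ 1)"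
    and "christoffel (cigar b) 1 1 2 x = - (b * A * x $ 2) + C * (x $ 1 * x $ 1 * x $ 2)"
    and "christoffel (cigar b) 1 2 1 x = - (b * A * x $ 2) + C * (x $ 1 * x $ 1 * x $ 2)"
    and "christoffel (cigar b) 1 2 2 x = B * x $ 1 + C * (x $ 1 * x $ 2 * x $ 2)"
    and "christoffel (cigar b) 2 1 1 x = B * x $ 2 + C * (x $ 1 * x $ 1 * x $ 2)"
    and "christoffel (cigar b) 2 1 2 x = - (b * A * x $ 1) + C * (x $ 1 * x $ 2 * x $ 2)"
    and "christoffel (cigar b) 2 2 1 x = - (b * A * x $ 1) + C * (x $ 1 * x $ 2 * x $ 2)"
    and "christoffel (cigar b) 2 2 2 x = (B - 2 * b * A) * x $ 2 + C * (x $ 2 * x $ 2 * x $ 2)"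
  using sig_eq[of x] unfolding christoffel_def matrix_inv_cigar sum_2
    has_grad_cigar[THEN has_grad_partial(1)] has_grad_cigar[THEN has_grad_partial(2)]
    cigar_inv_def vector_2 A_def B_def C_def
  by (simp_all, (algebra | simp add: algebra_simps)+)


text \<open>These four derivatives are the ones that occur in \<open>riemann\<close> with indices 1,
  2, 2. The factors \<open>B'\<close> and \<open>C'\<close> are such that the gradients of
  \<open>B\<close> and \<open>C\<close> are \<open>B'\<close> and \<open>C'\<close> times the
  position vector.\<close>

lemma has_grad_christoffel_cigar:
  fixes x :: plane
  defines "A \<equiv> sig b x" and "B \<equiv> b * sig b x * (1 + sig b x + sig b x * sig b x)"
    and "C \<equiv> b * b * sig b x * sig b x * (2 + sig b x)"
    and "B' \<equiv> - 2 * b * b * sig b x * sig b x * (1 + 2 * sig b x + 3 * sig b x * sig b x)"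
    and "C' \<equiv> - 2 * b * b * b * sig b x * sig b x * (4 * sig b x + 3 * sig b x * sig b x)"
  shows "partial 1 (christoffel (cigar b) 1 2 2) x =
      B + B' * (x $ 1 * x $ 1) + C * (x $ 2 * x $ 2) + C' * (x $ 1 * x $ 1 * x $ 2 * x $ 2)"
    and "partial 2 (christoffel (cigar b) 1 1 2) x =
      - b * A + 2 * b * b * A * A * (x $ 2 * x $ 2) + C * (x $ 1 * x $ 1) + C' * (x $ 1 * x $ 1 * x $ 2 * x $ 2)"
    and "partial 1 (christoffel (cigar b) 2 2 2) x =
      (B' + 4 * b * b * A * A) * x $ 1 * x $ 2 + C' * (x $ 1 * x $ 2 * x $ 2 * x $ 2)"
    and "partial 2 (christoffel (cigar b) 2 1 2) x =
      (2 * b * b * A * A + 2 * C) * x $ 1 * x $ 2 + C' * (x $ 1 * x $ 2 * x $ 2 * x $ 2)"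
proof -
  have c: "christoffel (cigar b) 1 2 2 = (\<lambda>x. b * sig b x * (1 + sig b x + sig b x * sig b x) * x $ 1
        + b * b * sig b x * sig b x * (2 + sig b x) * (x $ 1 * x $ 2 * x $ 2))"
    "christoffel (cigar b) 1 1 2 = (\<lambda>x. 0 - b * sig b x * x $ 2
        + b * b * sig b x * sig b x * (2 + sig b x) * (x $ 1 * x $ 1 * x $ 2))"
    "christoffel (cigar b) 2 2 2 =
      (\<lambda>x. (b * sig b x * (1 + sig b x + sig b x * sig b x) - 2 * b * sig b x) * x $ 2
        + b * b * sig b x * sig b x * (2 + sig b x) * (x $ 2 * x $ 2 * x $ 2))"
    "christoffel (cigar b) 2 1 2 = (\<lambda>x. 0 - b * sig b x * x $ 1
        + b * b * sig b x * sig b x * (2 + sig b x) * (x $ 1 * x $ 2 * x $ 2))"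
    by (rule ext, simp add: christoffel_cigar)+
  show "partial 1 (christoffel (cigar b) 1 2 2) x =
      B + B' * (x $ 1 * x $ 1) + C * (x $ 2 * x $ 2) + C' * (x $ 1 * x $ 1 * x $ 2 * x $ 2)"
    unfolding c B_def C_def B'_def C'_def
    by (subst has_grad_partial(1), (rule has_grad_intros has_grad_sig)+, simp add: algebra_simps)
  show "partial 2 (christoffel (cigar b) 1 1 2) x =
      - b * A + 2 * b * b * A * A * (x $ 2 * x $ 2) + C * (x $ 1 * x $ 1) + C' * (x $ 1 * x $ 1 * x $ 2 * x $ 2)"
    unfolding c A_def C_def C'_def
    by (subst has_grad_partial(2), (rule has_grad_intros has_grad_sig)+, simp add: algebra_simps)
  show "partial 1 (christoffel (cigar b) 2 2 2) x =
      (B' + 4 * b * b * A * A) * x $ 1 * x $ 2 + C' * (x $ 1 * x $ 2 * x $ 2 * x $ 2)"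
    unfolding c A_def B'_def C'_def
    by (subst has_grad_partial(1), (rule has_grad_intros has_grad_sig)+, simp add: algebra_simps)
  show "partial 2 (christoffel (cigar b) 2 1 2) x =
      (2 * b * b * A * A + 2 * C) * x $ 1 * x $ 2 + C' * (x $ 1 * x $ 2 * x $ 2 * x $ 2)"
    unfolding c A_def C_def C'_def
    by (subst has_grad_partial(2), (rule has_grad_intros has_grad_sig)+, simp add: algebra_simps)
qed

text \<open>In dimension two, R(d1, d2) d2 = K (g22 d1 - g12 d2) with K the Gauss curvature, so the
  common factor is K. Contracting with the metric then gives K times the determinant.\<close>

lemma riemann_cigar:
  "riemann (cigar b) 1 1 2 2 x = 4 * b * sig b x ^ 3 * cigar b x $ 2 $ 2"
  "riemann (cigar b) 2 1 2 2 x = - (4 * b * sig b x ^ 3 * cigar b x $ 1 $ 2)"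
  using sig_eq[of x]
  unfolding riemann_def sum_2 has_grad_christoffel_cigar christoffel_cigar cigar_def vector_2
  by algebra+

lemma gauss_curvature_cigar: "gauss_curvature (cigar b) x = 4 * b * sig b x ^ 3"
proof -
  have "cigar b x $ 1 $ 2 = cigar b x $ 2 $ 1" by (simp add: cigar_def)
  with det_cigar[of x] show ?thesis
    unfolding gauss_curvature_def det_cigar sum_2 riemann_cigar det_2 by algebra
qed

section \<open>Area, smoothness, positivity and rotation invariance\<close>

lemma has_area_cigar: "has_area (cigar b) pi"
proof -
  have "((\<lambda>_. 1) has_integral measure lebesgue (cball (0::plane) 1)) (cball (0::plane) 1)"
    using lmeasurable_iff_has_integral[of "cball (0::plane) 1"]
      has_integral_restrict_UNIV[of "cball (0::plane) 1" "\<lambda>_. 1 :: real"]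
    by (simp add: indicator_def[abs_def] of_bool_def)
  then show ?thesis
    by (simp add: has_area_def det_cigar content_cball unit_ball_vol_2)
qed

lemma Ck_on_sig: "Ck_on k (sig b) UNIV"
proof (induction k)
  case 0
  have "continuous (at x) (sig b)" for x
    using has_grad_sig[of x] unfolding has_grad_def by (rule has_derivative_continuous)
  then show ?case by (simp add: continuous_at_imp_continuous_on)
next
  case (Suc k)
  have "Ck_on k (partial i (sig b)) UNIV" for i
  proof (rule Ck_on_cong[OF open_UNIV])
    show "- 2 * b * x $ i * (sig b x * sig b x) = partial i (sig b) x" for x
      using has_grad_partial[OF has_grad_sig] exhaust_2[of i] by (elim disjE) simp_all
    show "Ck_on k (\<lambda>x. - 2 * b * x $ i * (sig b x * sig b x)) UNIV"
      by (intro Ck_on_mult Ck_on_const Ck_on_coord Suc) simp_all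
  qed
  then show ?case using has_grad_differentiable[OF has_grad_sig] by simp
qed

lemma riemannian_metric_cigar: "riemannian_metric (cigar b)"
proof -
  have "smooth_on_disc (\<lambda>x. cigar b x $ i $ j)" for i j
    unfolding smooth_on_disc_def
  proof (intro exI[of _ UNIV] conjI allI)
    show "Ck_on k (\<lambda>x. cigar b x $ i $ j) UNIV" for k
      using exhaust_2[of i] exhaust_2[of j] unfolding cigar_def
      by (elim disjE; hypsubst; unfold vector_2;
          intro Ck_on_add Ck_on_mult Ck_on_const Ck_on_coord Ck_on_sig open_UNIV)
  qed simp_all
  moreover have "transpose (cigar b x) = cigar b x" for x
    by (simp add: vec_eq_iff forall_2 transpose_def cigar_def)
  moreover have "v \<bullet> (cigar b x *v v) > 0" if "v \<noteq> 0" for x v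
  proof -
    have "v \<bullet> (cigar b x *v v) =
        sig b x * (v \<bullet> v) + b * (1 + sig b x) * (x $ 1 * v $ 1 + x $ 2 * v $ 2)\<^sup>2"
      by (simp add: inner_vec_def matrix_vector_mult_def sum_2 cigar_def power2_eq_square algebra_simps)
    moreover have "b * (1 + sig b x) * (x $ 1 * v $ 1 + x $ 2 * v $ 2)\<^sup>2 \<ge> 0"
      using b sig_pos[of x] by simp
    ultimately show ?thesis using that sig_pos[of x] by (simp add: add_pos_nonneg)
  qed
  ultimately show ?thesis by (simp add: riemannian_metric_def)
qed

lemma S1_invariant_metric_cigar: "S1_invariant_metric (cigar b)"
  unfolding S1_invariant_metric_def
proof (intro allI ballI)
  fix t and x :: plane
  define y where "y = rotation t *v x"
  have y: "y $ 1 = cos t * x $ 1 - sin t * x $ 2" "y $ 2 = sin t * x $ 1 + cos t * x $ 2"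
    by (simp_all add: y_def rotation_def matrix_vector_mult_def sum_2)
  have cs: "sin t * sin t + cos t * cos t = 1"
    using sin_cos_squared_add[of t] by (simp add: power2_eq_square)
  then have "y $ 1 * y $ 1 + y $ 2 * y $ 2 = x $ 1 * x $ 1 + x $ 2 * x $ 2"
    unfolding y by algebra
  then have sig: "sig b y = sig b x" by (simp add: sig_def)
  have "transpose (rotation t) ** cigar b y ** rotation t = cigar b x"
    using cs
    unfolding vec_eq_iff forall_2 matrix_matrix_mult_def transpose_def cigar_def sig y
      vec_lambda_beta sum_2 rotation_def vector_2
    by (intro conjI; algebra)
  then show "transpose (rotation t) ** cigar b (rotation t *v x) ** rotation t = cigar b x"
    by (simp add: y_def)
qed

end


section \<open>Separation of variables\<close>

lemma has_grad_along_curve: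
  assumes "has_grad f a c (vector [X t, Y t])"
    and X: "(X has_real_derivative X') (at t)" and Y: "(Y has_real_derivative Y') (at t)"
  shows "((\<lambda>t. f (vector [X t, Y t])) has_real_derivative a * X' + c * Y') (at t)"
proof -
  have v: "vector [p, q] = (p *\<^sub>R axis 1 1 + q *\<^sub>R axis 2 1 :: plane)" for p q :: real
    by (simp add: vec_eq_iff forall_2)
  have "((\<lambda>t. vector [X t, Y t] :: plane) has_derivative
      (\<lambda>h. (X' * h) *\<^sub>R axis 1 1 + (Y' * h) *\<^sub>R axis 2 1)) (at t)"
    using X Y unfolding v has_field_derivative_def by (auto intro!: derivative_eq_intros)
  from has_derivative_compose[OF this assms(1)[unfolded has_grad_def]]
  have "((\<lambda>t. f (vector [X t, Y t])) has_derivative (\<lambda>h. a * (X' * h) + c * (Y' * h))) (at t)"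
    by simp
  moreover have "(\<lambda>h. a * (X' * h) + c * (Y' * h)) = (*) (a * X' + c * Y')"
    by (rule ext) (simp add: algebra_simps)
  ultimately show ?thesis
    by (simp add: has_field_derivative_def)
qed

section \<open>Polar coordinates\<close>

lemma polar_nth [simp]: "polar r t $ 1 = r * cos t" "polar r t $ 2 = r * sin t"
  by (simp_all add: polar_def)

lemma norm_plane: "norm (x :: plane) = sqrt (x $ 1 * x $ 1 + x $ 2 * x $ 2)"
  by (simp add: norm_vec_def L2_set_def sum_2 power2_eq_square)

lemma norm_polar: "r \<ge> 0 \<Longrightarrow> norm (polar r t) = r"
proof -
  assume "r \<ge> 0"
  have "r * cos t * (r * cos t) + r * sin t * (r * sin t) = r\<^sup>2"
    using sin_cos_squared_add[of t] by algebra
  then show ?thesis using \<open>r \<ge> 0\<close> by (simp add: norm_plane)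
qed

lemma plane_eq_polar: obtains t where "x = polar (norm x) t"
proof (cases "x = 0")
  case True
  then show ?thesis using that[of 0] by (simp add: polar_def vec_eq_iff forall_2)
next
  case False
  have n: "(norm x)\<^sup>2 = x $ 1 * x $ 1 + x $ 2 * x $ 2"
    by (simp add: norm_plane)
  have "(x $ 1 / norm x)\<^sup>2 + (x $ 2 / norm x)\<^sup>2 = (x $ 1 * x $ 1 + x $ 2 * x $ 2) / (norm x)\<^sup>2"
    by (simp add: power2_eq_square add_divide_distrib)
  also have "\<dots> = 1"
    using False by (simp flip: n)
  finally have "(x $ 1 / norm x)\<^sup>2 + (x $ 2 / norm x)\<^sup>2 = 1" .
  then obtain t where "x $ 1 / norm x = cos t" "x $ 2 / norm x = sin t"
    using sincos_total_2pi[of "x $ 1 / norm x" "x $ 2 / norm x"] by metis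
  then have "x = polar (norm x) t"
    using False unfolding vec_eq_iff forall_2 polar_nth by (metis nonzero_eq_divide_eq mult.commute norm_eq_zero)
  then show ?thesis using that by blast
qed

lemma rotation_polar: "rotation t *v polar r s = polar r (s + t)"
  by (simp add: vec_eq_iff forall_2 rotation_def matrix_vector_mult_def sum_2 cos_add sin_add algebra_simps)

lemma smooth_on_disc_has_grad:
  assumes "smooth_on_disc u" "x \<in> cball 0 1"
  shows "has_grad u (partial 1 u x) (partial 2 u x) x"
    and "has_grad (partial i u) (partial 1 (partial i u) x) (partial 2 (partial i u) x) x"
proof -
  from assms obtain U where "x \<in> U" "Ck_on 1 u U" "Ck_on 2 u U"
    by (auto simp: smooth_on_disc_def simp del: Ck_on.simps)
  then show "has_grad u (partial 1 u x) (partial 2 u x) x"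
    and "has_grad (partial i u) (partial 1 (partial i u) x) (partial 2 (partial i u) x) x"
    by (auto intro!: differentiable_has_grad simp: numeral_2_eq_2)
qed

text \<open>\<open>p\<close> is the profile of an eigenfunction \<open>p r * cos (k t)\<close> and \<open>y = r \<sigma> p'\<close> its flux.\<close>

definition radial_mode :: "real \<Rightarrow> boundary_condition \<Rightarrow> nat \<Rightarrow> real \<Rightarrow> (real \<Rightarrow> real) \<Rightarrow> (real \<Rightarrow> real) \<Rightarrow> bool" where
  "radial_mode b bc k \<gamma> p y \<longleftrightarrow>
     continuous_on {0..1} p \<and> continuous_on {0..1} y \<and>
     (\<forall>r\<in>{0<..<1}. (p has_real_derivative (1 + b * r\<^sup>2) / r * y r) (at r)) \<and>
     (\<forall>r\<in>{0<..<1}. (y has_real_derivative ((real k)\<^sup>2 * (1 + b * r\<^sup>2) / r - \<gamma> * r) * p r) (at r)) \<and>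
     y 0 = 0 \<and> (if bc = Dirichlet then p 1 = 0 else y 1 = 0) \<and> (\<exists>r\<in>{0..1}. p r \<noteq> 0)"

context
  fixes b :: real
  assumes b: "b > 0"
begin

text \<open>Determinant 1 removes the volume density and makes the inverse the adjugate, so the
  divergence form expands in the entries of the metric itself. The two mixed derivatives stay
  separate, which avoids any appeal to their symmetry.\<close>

lemma laplace_cigar:
  fixes x :: plane
  assumes u1: "has_grad (partial 1 u) u11 u12 x" and u2: "has_grad (partial 2 u) u21 u22 x"
  shows "laplace_beltrami (cigar b) u x =
      cigar b x $ 2 $ 2 * u11 - cigar b x $ 1 $ 2 * (u21 + u12) + cigar b x $ 1 $ 1 * u22
      + (partial 1 (\<lambda>x. cigar b x $ 2 $ 2) x - partial 2 (\<lambda>x. cigar b x $ 1 $ 2) x) * partial 1 u x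
      + (partial 2 (\<lambda>x. cigar b x $ 1 $ 1) x - partial 1 (\<lambda>x. cigar b x $ 1 $ 2) x) * partial 2 u x"
proof -
  note g = has_grad_cigar[OF b, of x]
  have inv: "cigar_inv b y $ 1 $ 1 = cigar b y $ 2 $ 2" "cigar_inv b y $ 1 $ 2 = 0 - cigar b y $ 1 $ 2"
     "cigar_inv b y $ 2 $ 1 = 0 - cigar b y $ 1 $ 2" "cigar_inv b y $ 2 $ 2 = cigar b y $ 1 $ 1" for y
    by (simp_all add: cigar_def cigar_inv_def)
  have "partial 1 (\<lambda>y. cigar_inv b y $ 1 $ 1 * partial 1 u y + cigar_inv b y $ 1 $ 2 * partial 2 u y) x =
    cigar b x $ 2 $ 2 * u11 - cigar b x $ 1 $ 2 * u21 + partial 1 (\<lambda>x. cigar b x $ 2 $ 2) x * partial 1 u x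
    - partial 1 (\<lambda>x. cigar b x $ 1 $ 2) x * partial 2 u x"
    unfolding inv g[THEN has_grad_partial(1)] g[THEN has_grad_partial(2)]
    by (subst has_grad_partial(1), (rule has_grad_const has_grad_add has_grad_diff has_grad_mult g u1 u2)+)
      (simp add: algebra_simps)
  moreover
  have "partial 2 (\<lambda>y. cigar_inv b y $ 2 $ 1 * partial 1 u y + cigar_inv b y $ 2 $ 2 * partial 2 u y) x =
    cigar b x $ 1 $ 1 * u22 - cigar b x $ 1 $ 2 * u12 + partial 2 (\<lambda>x. cigar b x $ 1 $ 1) x * partial 2 u x
    - partial 2 (\<lambda>x. cigar b x $ 1 $ 2) x * partial 1 u x"
    unfolding inv g[THEN has_grad_partial(1)] g[THEN has_grad_partial(2)]
    by (subst has_grad_partial(2), (rule has_grad_const has_grad_add has_grad_diff has_grad_mult g u1 u2)+)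
      (simp add: algebra_simps)
  ultimately show ?thesis
    by (simp add: laplace_beltrami_def det_cigar[OF b] matrix_inv_cigar[OF b] sum_2 algebra_simps)
qed

text \<open>The equation is read off along the positive first axis, where the metric is diagonal and
  the mixed derivatives drop out. Derivatives in the second direction are recovered from the known
  dependence on the angle along circles.\<close>

lemma eigenfunction_radial_mode:
  assumes eig: "eigenfunction bc (cigar b) \<gamma> u"
    and polar: "\<And>r t. 0 \<le> r \<Longrightarrow> r \<le> 1 \<Longrightarrow> u (polar r t) = \<phi> r * cos (real k * t)"
  obtains p y where "radial_mode b bc k \<gamma> p y"
proof -
  define p where "p r = u (polar r 0)" for r
  define p1 where "p1 r = partial 1 u (polar r 0)" for r
  define y where "y r = r / (1 + b * r\<^sup>2) * p1 r" for r
  note sm = smooth_on_disc_has_grad[OF eig[unfolded eigenfunction_def, THEN conjunct1]]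
  have D: "1 + b * r\<^sup>2 > 0" for r
    using b by (simp add: add_pos_nonneg)
  have dom: "polar r t \<in> cball 0 1" if "0 \<le> r" "r \<le> 1" for r t
    using that by (simp add: norm_polar)
  have ray: "((\<lambda>r. f (polar r 0)) has_real_derivative a) (at r)" if "has_grad f a c (polar r 0)" for f a c r
    using has_grad_along_curve[of f a c "\<lambda>r. r * cos 0" r "\<lambda>r. r * sin 0" 1 0] that
    by (simp add: polar_def)
  have p': "(p has_real_derivative p1 r) (at r)" if "0 \<le> r" "r \<le> 1" for r
    unfolding p_def p1_def by (rule ray[OF sm(1)[OF dom[OF that]]])
  have p1': "(p1 has_real_derivative partial 1 (partial 1 u) (polar r 0)) (at r)"
    if "0 \<le> r" "r \<le> 1" for r
    unfolding p1_def by (rule ray[OF sm(2)[OF dom[OF that]]])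
  have circ: "((\<lambda>t. f (polar r t)) has_real_derivative a * (- (r * sin t)) + c * (r * cos t)) (at t)"
    if "has_grad f a c (polar r t)" for f a c r t
    using that unfolding polar_def
    by (rule has_grad_along_curve) (auto intro!: derivative_eq_intros)
  have ang: "- (r * sin t) * partial 1 u (polar r t) + r * cos t * partial 2 u (polar r t)
      = - (real k * \<phi> r * sin (real k * t))" if "0 \<le> r" "r \<le> 1" for r t
  proof -
    have "((\<lambda>t. u (polar r t)) has_real_derivative - (real k * \<phi> r * sin (real k * t))) (at t)"
      unfolding polar[OF that] by (auto intro!: derivative_eq_intros)
    from DERIV_unique[OF this circ[OF sm(1)[OF dom[OF that]]]] show ?thesis
      by (simp add: algebra_simps)
  qed
  have uy: "partial 2 u (polar r 0) = 0" if "0 < r" "r \<le> 1" for r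
    using ang[of r 0] that by simp
  \<comment> \<open>Since \<open>ang\<close> holds for all angles it can be differentiated once more
    at angle 0; comparison with the second derivative of \<open>cos (real k * t)\<close> isolates
    the second partial derivative.\<close>
  have uyy: "r\<^sup>2 * partial 2 (partial 2 u) (polar r 0) = r * p1 r - (real k)\<^sup>2 * p r"
    if "0 < r" "r \<le> 1" for r
  proof -
    have r: "0 \<le> r" using that by simp
    let ?G = "\<lambda>t. - (r * sin t) * partial 1 u (polar r t) + r * cos t * partial 2 u (polar r t)"
    note d1 = circ[OF sm(2)[OF dom[OF r that(2), of 0], of 1]]
    note d2 = circ[OF sm(2)[OF dom[OF r that(2), of 0], of 2]]
    have "(?G has_real_derivative - (r * p1 r) + r\<^sup>2 * partial 2 (partial 2 u) (polar r 0)) (at 0)"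
      by (rule derivative_eq_intros d1 d2 refl | simp add: p1_def power2_eq_square)+
    moreover have "(?G has_real_derivative - ((real k)\<^sup>2 * \<phi> r)) (at 0)"
      unfolding ang[OF r that(2)] by (auto intro!: derivative_eq_intros simp: power2_eq_square)
    moreover have "p r = \<phi> r" using polar[OF r that(2), of 0] by (simp add: p_def)
    ultimately show ?thesis using DERIV_unique by fastforce
  qed
  have "radial_mode b bc k \<gamma> p y"
    unfolding radial_mode_def
  proof (intro conjI ballI)
    show "continuous_on {0..1} p"
      by (rule DERIV_continuous_on[OF DERIV_subset[OF p']]) auto
    have "continuous_on {0..1} p1"
      by (rule DERIV_continuous_on[OF DERIV_subset[OF p1']]) auto
    moreover have "1 + b * r\<^sup>2 \<noteq> 0" for r using D[of r] by simp
    ultimately show "continuous_on {0..1} y"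
      unfolding y_def[abs_def] by (intro continuous_intros) auto
    show "y 0 = 0" by (simp add: y_def)
    show "if bc = Dirichlet then p 1 = 0 else y 1 = 0"
    proof (cases bc)
      case Dirichlet
      have "polar 1 0 \<in> sphere 0 1" using norm_polar[of 1 0] by simp
      with Dirichlet eig show ?thesis by (simp add: eigenfunction_def p_def)
    next
      case Neumann
      have "polar 1 0 \<in> sphere 0 1" using norm_polar[of 1 0] by simp
      with Neumann eig have "conormal_derivative (cigar b) u (polar 1 0) = 0"
        by (simp add: eigenfunction_def)
      then have "sig b (polar 1 0) * p1 1 = 0"
        using uy[of 1]
        by (simp add: conormal_derivative_def matrix_inv_cigar[OF b] cigar_inv_def sum_2
            matrix_vector_mult_def p1_def)
      then have "p1 1 = 0" using sig_pos[OF b] by (metis less_irrefl mult_eq_0_iff)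
      with Neumann show ?thesis by (simp add: y_def)
    qed
    show "\<exists>r\<in>{0..1}. p r \<noteq> 0"
    proof -
      obtain x where x: "norm x \<le> 1" "u x \<noteq> 0" using eig by (auto simp: eigenfunction_def)
      obtain t where "x = polar (norm x) t" by (rule plane_eq_polar)
      then have "\<phi> (norm x) \<noteq> 0" using polar[of "norm x" t] x by auto
      moreover have "p (norm x) = \<phi> (norm x)" using polar[of "norm x" 0] x by (simp add: p_def)
      ultimately show ?thesis using x by (intro bexI[of _ "norm x"]) auto
    qed
    fix r :: real assume r: "r \<in> {0<..<1}"
    then have r01: "0 < r" "0 \<le> r" "r \<le> 1" by auto
    have "(1 + b * r\<^sup>2) / r * y r = p1 r"
      using D[of r] r by (simp add: y_def)
    then show "(p has_real_derivative (1 + b * r\<^sup>2) / r * y r) (at r)" using p'[of r] r by simp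
    define A where "A = 1 / (1 + b * r\<^sup>2)"
    have A: "A * (1 + b * r\<^sup>2) = 1" using D[of r] by (simp add: A_def)
    have sig: "sig b (polar r 0) = A" by (simp add: sig_def A_def power2_eq_square)
    have "polar r 0 \<in> ball 0 1" using r by (simp add: norm_polar)
    then have "laplace_beltrami (cigar b) u (polar r 0) + \<gamma> * p r = 0"
      using eig by (simp add: eigenfunction_def p_def)
    then have lap: "A * partial 1 (partial 1 u) (polar r 0)
       + (A + b * (1 + A) * (r * r)) * partial 2 (partial 2 u) (polar r 0)
       + (- (2 * b * r * (A * A)) - b * r * (1 + A)) * p1 r + \<gamma> * p r = 0"
      unfolding laplace_cigar[OF sm(2)[OF dom[OF r01(2,3)]] sm(2)[OF dom[OF r01(2,3)]]]
        has_grad_cigar[OF b, THEN has_grad_partial(1)] has_grad_cigar[OF b, THEN has_grad_partial(2)]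
      by (simp add: cigar_def sig uy r01 p1_def)
    have "((\<lambda>r. r / (1 + b * r\<^sup>2)) has_real_derivative A - 2 * b * r\<^sup>2 * (A * A)) (at r)"
    proof (rule DERIV_cong)
      show "((\<lambda>r. r / (1 + b * r\<^sup>2)) has_real_derivative
          (1 * (1 + b * r\<^sup>2) - r * (b * (2 * r))) / ((1 + b * r\<^sup>2) * (1 + b * r\<^sup>2))) (at r)"
        using D[of r] by (auto intro!: derivative_eq_intros)
      show "(1 * (1 + b * r\<^sup>2) - r * (b * (2 * r))) / ((1 + b * r\<^sup>2) * (1 + b * r\<^sup>2))
          = A - 2 * b * r\<^sup>2 * (A * A)"
        unfolding diff_divide_distrib A_def using D[of r] by (simp add: power2_eq_square)
    qed
    from DERIV_mult[OF this p1'[OF r01(2,3)]]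
    have "(y has_real_derivative (A - 2 * b * r\<^sup>2 * (A * A)) * p1 r
        + partial 1 (partial 1 u) (polar r 0) * (r * A)) (at r)"
      unfolding y_def[abs_def] by (simp add: A_def)
    moreover have "(A - 2 * b * r\<^sup>2 * (A * A)) * p1 r + partial 1 (partial 1 u) (polar r 0) * (r * A)
        = ((real k)\<^sup>2 * (1 + b * r\<^sup>2) / r - \<gamma> * r) * p r"
    proof -
      \<comment> \<open>Multiplying by \<open>r\<close> clears the denominator, so that the claim
        becomes a polynomial consequence of \<open>lap\<close>, \<open>A\<close> and
        \<open>uyy\<close>.\<close>
      have "r * ((A - 2 * b * r\<^sup>2 * (A * A)) * p1 r + partial 1 (partial 1 u) (polar r 0) * (r * A))
          = ((real k)\<^sup>2 * (1 + b * r\<^sup>2) - \<gamma> * r * r) * p r"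
        using lap A uyy[OF r01(1,3)] unfolding power2_eq_square by algebra
      then show ?thesis using r01(1) by (simp add: field_simps power2_eq_square)
    qed
    ultimately show "(y has_real_derivative ((real k)\<^sup>2 * (1 + b * r\<^sup>2) / r - \<gamma> * r) * p r) (at r)"
      by simp
  qed
  then show ?thesis by (rule that)
qed

end


section \<open>The radial equation\<close>

text \<open>A backward Gronwall argument: the derivative of p^2 + y^2 is 2 (\<alpha> + \<beta>) p y,
  at least -K (p^2 + y^2), so multiplication by \<open>exp (K * r)\<close> gives a nondecreasing
  function that vanishes at \<open>c\<close>. Going from right to left keeps away from the singular
  point 0 in the applications.\<close>

lemma linear_system_unique:
  fixes p y :: "real \<Rightarrow> real"
  assumes "continuous_on {a..c} p" "continuous_on {a..c} y"
    and p': "\<And>r. a < r \<Longrightarrow> r < c \<Longrightarrow> (p has_real_derivative \<alpha> r * y r) (at r)"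
    and y': "\<And>r. a < r \<Longrightarrow> r < c \<Longrightarrow> (y has_real_derivative \<beta> r * p r) (at r)"
    and K: "\<And>r. a < r \<Longrightarrow> r < c \<Longrightarrow> \<bar>\<alpha> r + \<beta> r\<bar> \<le> K"
    and "p c = 0" "y c = 0" "r \<in> {a..c}"
  shows "p r = 0 \<and> y r = 0"
proof -
  define G where "G r = ((p r)\<^sup>2 + (y r)\<^sup>2) * exp (K * r)" for r
  have "G r \<le> G c"
  proof (rule DERIV_nonneg_imp_increasing_open[of r c G])
    show "continuous_on {r..c} G"
      unfolding G_def[abs_def] using assms(1,2,8)
      by (intro continuous_intros) (auto intro: continuous_on_subset)
    fix x assume x: "r < x" "x < c"
    then have ax: "a < x" using assms(8) by auto
    let ?d = "(2 * (\<alpha> x + \<beta> x) * (p x * y x) + K * ((p x)\<^sup>2 + (y x)\<^sup>2)) * exp (K * x)"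
    have "(G has_real_derivative ?d) (at x)"
      unfolding G_def[abs_def]
      by (rule p'[OF ax x(2)] y'[OF ax x(2)] derivative_eq_intros refl | simp)+
        (simp add: algebra_simps power2_eq_square)
    moreover have "0 \<le> ?d"
    proof (rule mult_nonneg_nonneg)
      have "\<bar>2 * (p x * y x)\<bar> \<le> (p x)\<^sup>2 + (y x)\<^sup>2"
        using sum_squares_bound[of "p x" "y x"] sum_squares_bound[of "p x" "- y x"] by (simp add: abs_le_iff)
      then have "\<bar>\<alpha> x + \<beta> x\<bar> * \<bar>2 * (p x * y x)\<bar> \<le> K * ((p x)\<^sup>2 + (y x)\<^sup>2)"
        using K[OF ax x(2)] by (intro mult_mono) auto
      then have "\<bar>2 * (\<alpha> x + \<beta> x) * (p x * y x)\<bar> \<le> K * ((p x)\<^sup>2 + (y x)\<^sup>2)"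
        by (simp only: abs_mult mult_ac)
      then show "0 \<le> 2 * (\<alpha> x + \<beta> x) * (p x * y x) + K * ((p x)\<^sup>2 + (y x)\<^sup>2)"
        by linarith
    qed simp
    ultimately show "\<exists>d. (G has_real_derivative d) (at x) \<and> 0 \<le> d" by blast
  qed (use assms(8) in auto)
  then have "(p r)\<^sup>2 + (y r)\<^sup>2 \<le> 0"
    using assms(6,7) by (simp add: G_def mult_le_0_iff)
  then show ?thesis
    by (metis sum_power2_le_zero_iff)
qed

text \<open>The energy identity (p y)' = \<beta> p^2 + \<alpha> y^2 makes p y monotone. Being 0 at
  both ends, it is constant, so its derivative and hence p vanish inside; continuity gives the end
  points. The product form of the end conditions treats Dirichlet and Neumann alike.\<close>

lemma positive_potential_imp_zero:
  fixes p y :: "real \<Rightarrow> real"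
  assumes cont: "continuous_on {0..1} p" "continuous_on {0..1} y"
    and p': "\<And>r. 0 < r \<Longrightarrow> r < 1 \<Longrightarrow> (p has_real_derivative \<alpha> r * y r) (at r)"
    and y': "\<And>r. 0 < r \<Longrightarrow> r < 1 \<Longrightarrow> (y has_real_derivative \<beta> r * p r) (at r)"
    and pos: "\<And>r. 0 < r \<Longrightarrow> r < 1 \<Longrightarrow> \<alpha> r > 0" "\<And>r. 0 < r \<Longrightarrow> r < 1 \<Longrightarrow> \<beta> r > 0"
    and "p 0 * y 0 = 0" "p 1 * y 1 = 0" "r \<in> {0..1}"
  shows "p r = 0"
proof -
  define P where "P r = p r * y r" for r
  define d where "d x = \<beta> x * (p x)\<^sup>2 + \<alpha> x * (y x)\<^sup>2" for x
  have P': "(P has_real_derivative d x) (at x)" if "0 < x" "x < 1" for x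
    unfolding P_def[abs_def] d_def
    by (rule p'[OF that] y'[OF that] derivative_eq_intros refl)+ (simp add: algebra_simps power2_eq_square)
  have d: "d x \<ge> 0" if "0 < x" "x < 1" for x
    using pos[OF that] by (simp add: d_def)
  have contP: "continuous_on {u..v} P" if "0 \<le> u" "v \<le> 1" for u v
    unfolding P_def[abs_def] by (intro continuous_intros continuous_on_subset[OF cont(1)]
        continuous_on_subset[OF cont(2)]) (use that in auto)
  have mono: "P u \<le> P v" if "0 \<le> u" "u \<le> v" "v \<le> 1" for u v
  proof (rule DERIV_nonneg_imp_increasing_open[of u v P])
    show "\<exists>y. (P has_real_derivative y) (at x) \<and> 0 \<le> y" if "u < x" "x < v" for x
      using P'[of x] d[of x] that \<open>0 \<le> u\<close> \<open>v \<le> 1\<close> by auto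
  qed (use contP that in auto)
  have P0: "P x = 0" if "x \<in> {0..1}" for x
    using mono[of 0 x] mono[of x 1] that assms(7,8) by (simp add: P_def)
  have p0: "p x = 0" if "x \<in> {0<..<1}" for x
  proof -
    have "((\<lambda>_. 0) has_real_derivative d x) (at x)"
      using P'[of x] that by (rule_tac has_field_derivative_transform_within_open[of P _ _ "{0<..<1}"])
        (auto simp: P0)
    then have "d x = 0" using DERIV_unique DERIV_const by blast
    moreover have "\<beta> x > 0" "\<alpha> x > 0" using pos that by auto
    ultimately show ?thesis
      by (simp add: d_def add_nonneg_eq_0_iff)
  qed
  show ?thesis
    by (rule continuous_constant_on_closure[of "{0<..<1}" p 0]) (use cont(1) p0 assms(9) in auto)
qed

text \<open>Comparing the coefficients of s^(n+1) in s v'' + (\<gamma> / 4) (1 + b s) v = 0 gives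
  the recurrence. The first two values select and normalise the solution that is regular at the
  singular point s = 0.\<close>

fun coef :: "real \<Rightarrow> real \<Rightarrow> nat \<Rightarrow> real" where
  "coef b \<gamma> 0 = 0"
| "coef b \<gamma> (Suc 0) = 1"
| "coef b \<gamma> (Suc (Suc n)) =
     - (\<gamma> / 4) * (coef b \<gamma> (Suc n) + b * coef b \<gamma> n) / (real (Suc n) * real (Suc (Suc n)))"

text \<open>The \<open>j\<close>-th derivative in \<open>s\<close> of the solution of \<open>s v'' + (\<gamma> / 4) (1 + b s) v = 0\<close> with
  \<open>v 0 = 0\<close> and \<open>v' 0 = 1\<close>. As a function of \<open>s = r\<^sup>2\<close>, \<open>v'\<close> is the radial eigenfunction and \<open>v\<close> is
  proportional to its flux.\<close>

definition sol :: "real \<Rightarrow> nat \<Rightarrow> real \<Rightarrow> real \<Rightarrow> real" where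
  "sol b j \<gamma> s = (\<Sum>n. (diffs ^^ j) (coef b \<gamma>) n * s ^ n)"

context
  fixes b :: real
  assumes b: "b > 0"
begin

text \<open>Both earlier coefficients are weakened to the common bound M^(n+1) / n!, with M = 1 + G
  (1 + b); the denominator (n+1)(n+2) of the recurrence restores (n+2)!, and G (1 + b) is absorbed
  into M. The bound is uniform in \<gamma>, as joint continuity requires.\<close>

lemma coef_bound:
  assumes "\<bar>\<gamma>\<bar> \<le> G"
  shows "\<bar>coef b \<gamma> n\<bar> \<le> (1 + G * (1 + b)) ^ n / fact n"
  using b assms
proof (induction b \<gamma> n rule: coef.induct)
  case (3 b \<gamma> n)
  let ?M = "1 + G * (1 + b)"
  have G: "0 \<le> G" and M: "1 \<le> ?M" using 3 by auto
  have factor: "G * (Z / F + b * (Z / F)) / q = G * (1 + b) * Z / (q * F)"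
    if "F \<noteq> 0" "q \<noteq> 0" for Z F q :: real
    using that by (simp add: field_simps)
  have "\<bar>coef b \<gamma> (Suc (Suc n))\<bar> = \<bar>\<gamma>\<bar> / 4 * \<bar>coef b \<gamma> (Suc n) + b * coef b \<gamma> n\<bar> / (real (Suc n) * real (Suc (Suc n)))"
    by (simp add: abs_mult)
  also have "\<dots> \<le> G * (?M ^ Suc n / fact n + b * (?M ^ Suc n / fact n)) / (real (Suc n) * real (Suc (Suc n)))"
  proof (intro divide_right_mono mult_mono)
    have "\<bar>coef b \<gamma> (Suc n)\<bar> \<le> ?M ^ Suc n / fact (Suc n)" using 3 by simp
    also have "\<dots> \<le> ?M ^ Suc n / fact n"
      using M by (intro divide_left_mono fact_mono) auto
    finally have 1: "\<bar>coef b \<gamma> (Suc n)\<bar> \<le> ?M ^ Suc n / fact n" .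
    have "\<bar>coef b \<gamma> n\<bar> \<le> ?M ^ n / fact n" using 3 by simp
    also have "\<dots> \<le> ?M ^ Suc n / fact n"
      using M by (intro divide_right_mono power_increasing) auto
    finally have "b * \<bar>coef b \<gamma> n\<bar> \<le> b * (?M ^ Suc n / fact n)"
      using 3(3) by (intro mult_left_mono) auto
    with 1 show "\<bar>coef b \<gamma> (Suc n) + b * coef b \<gamma> n\<bar> \<le> ?M ^ Suc n / fact n + b * (?M ^ Suc n / fact n)"
      using 3(3) abs_triangle_ineq[of "coef b \<gamma> (Suc n)" "b * coef b \<gamma> n"] by (simp add: abs_mult)
  qed (use 3 G in auto)
  also have "\<dots> = G * (1 + b) * ?M ^ Suc n / (real (Suc n) * real (Suc (Suc n)) * fact n)"
    by (rule factor) simp_all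
  also have "\<dots> = G * (1 + b) * ?M ^ Suc n / fact (Suc (Suc n))"
    by (simp only: fact_Suc of_nat_mult of_nat_fact mult_ac)
  also have "\<dots> \<le> ?M * ?M ^ Suc n / fact (Suc (Suc n))"
    using M by (intro divide_right_mono mult_right_mono) auto
  finally show ?case by simp
qed auto

lemma diffs_coef_bound:
  assumes "\<bar>\<gamma>\<bar> \<le> G"
  shows "\<bar>(diffs ^^ j) (coef b \<gamma>) n\<bar> \<le> (1 + G * (1 + b)) ^ (n + j) / fact n"
proof (induction j arbitrary: n)
  case (Suc j)
  have "\<bar>(diffs ^^ Suc j) (coef b \<gamma>) n\<bar> = real (Suc n) * \<bar>(diffs ^^ j) (coef b \<gamma>) (Suc n)\<bar>"
    by (simp add: diffs_def abs_mult)
  also have "\<dots> \<le> real (Suc n) * ((1 + G * (1 + b)) ^ (Suc n + j) / fact (Suc n))"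
    by (intro mult_left_mono Suc) simp
  also have "\<dots> = (1 + G * (1 + b)) ^ (n + Suc j) / fact n"
    by (simp del: of_nat_Suc)
  finally show ?case .
qed (use coef_bound[OF assms] in simp)

lemma summable_majorant:
  "summable (\<lambda>n. M ^ (n + j) / fact n * t ^ n)" for M t :: real
proof -
  have "summable (\<lambda>n. M ^ j * ((M * t) ^ n / fact n))"
    using summable_exp[of "M * t"] by (intro summable_mult) (simp add: field_simps)
  then show ?thesis by (simp add: power_add power_mult_distrib field_simps)
qed

lemma summable_sol: "summable (\<lambda>n. (diffs ^^ j) (coef b \<gamma>) n * s ^ n)"
proof (rule summable_comparison_test'[OF summable_majorant])
  show "norm ((diffs ^^ j) (coef b \<gamma>) n * s ^ n) \<le> (1 + \<bar>\<gamma>\<bar> * (1 + b)) ^ (n + j) / fact n * \<bar>s\<bar> ^ n" for n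
    using mult_right_mono[OF diffs_coef_bound[of \<gamma> "\<bar>\<gamma>\<bar>" j n], of "\<bar>s\<bar> ^ n"]
    by (simp add: abs_mult power_abs)
qed

lemma sol_deriv: "((sol b j \<gamma>) has_real_derivative sol b (Suc j) \<gamma> s) (at s)"
  using termdiffs_strong_converges_everywhere[OF summable_sol]
  by (simp add: sol_def[abs_def])

lemma sol_deriv_chain:
  "(f has_real_derivative f') (at s) \<Longrightarrow>
    ((\<lambda>s. sol b j \<gamma> (f s)) has_real_derivative sol b (Suc j) \<gamma> (f s) * f') (at s)"
  by (rule DERIV_chain2[OF sol_deriv])

lemma sol_at_0: "sol b 0 \<gamma> 0 = 0" "sol b (Suc 0) \<gamma> 0 = 1"
  by (simp_all add: sol_def diffs_def)

lemma sol_ode: "s * sol b 2 \<gamma> s + \<gamma> / 4 * (1 + b * s) * sol b 0 \<gamma> s = 0"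
proof -
  let ?c = "coef b \<gamma>"
  have 0: "(\<lambda>n. ?c n * s ^ n) sums sol b 0 \<gamma> s"
    using summable_sol[of 0] by (simp add: sol_def summable_sums)
  have "(\<lambda>n. (diffs ^^ 2) ?c n * s ^ n) sums sol b 2 \<gamma> s"
    using summable_sol[of 2] by (simp add: sol_def summable_sums)
  from sums_mult[OF this, of s]
  have 2: "(\<lambda>n. s * ((diffs ^^ 2) ?c n * s ^ n)) sums (s * sol b 2 \<gamma> s)" .
  have 1: "(\<lambda>n. ?c (Suc n) * s ^ Suc n) sums sol b 0 \<gamma> s"
    using sums_Suc_iff[of "\<lambda>n. ?c n * s ^ n" "sol b 0 \<gamma> s"] 0 by simp
  have "(diffs ^^ 2) ?c n = - (\<gamma> / 4) * (?c (Suc n) + b * ?c n)" for n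
    by (simp add: numeral_2_eq_2 diffs_def del: of_nat_Suc)
  note coef2 = this
  have "s * ((diffs ^^ 2) ?c n * s ^ n)
      = - (\<gamma> / 4) * (?c (Suc n) * s ^ Suc n) + - (\<gamma> / 4) * (b * s) * (?c n * s ^ n)" for n
    unfolding coef2 by (simp add: algebra_simps)
  then have "(\<lambda>n. s * ((diffs ^^ 2) ?c n * s ^ n)) sums
      (- (\<gamma> / 4) * sol b 0 \<gamma> s + - (\<gamma> / 4) * (b * s) * sol b 0 \<gamma> s)"
    using sums_add[OF sums_mult[OF 1, of "- (\<gamma> / 4)"] sums_mult[OF 0, of "- (\<gamma> / 4) * (b * s)"]]
    by simp
  from sums_unique2[OF 2 this] show ?thesis by (simp add: field_simps)
qed

text \<open>The eigenfunction will be v', so its Laplacian contains v''' and the differentiated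
  equation is needed as well.\<close>

lemma sol_ode_deriv:
  "sol b 2 \<gamma> s + s * sol b 3 \<gamma> s + \<gamma> / 4 * (b * sol b 0 \<gamma> s + (1 + b * s) * sol b 1 \<gamma> s) = 0"
proof -
  have "((\<lambda>s. s * sol b 2 \<gamma> s + \<gamma> / 4 * (1 + b * s) * sol b 0 \<gamma> s) has_real_derivative
      sol b 2 \<gamma> s + s * sol b 3 \<gamma> s + \<gamma> / 4 * (b * sol b 0 \<gamma> s + (1 + b * s) * sol b 1 \<gamma> s)) (at s)"
    by (auto intro!: derivative_eq_intros sol_deriv_chain simp: eval_nat_numeral algebra_simps)
  then show ?thesis unfolding sol_ode using DERIV_unique DERIV_const by blast
qed

text \<open>Away from 0 the system for (v, v') has bounded coefficients, so a common zero propagates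
  down to every positive t. By continuity v' would vanish at 0, where it equals 1.\<close>

lemma sol_no_common_zero: 
  assumes s: "0 < s" and z: "sol b 0 \<gamma> s = 0" "sol b 1 \<gamma> s = 0"
  shows False
proof -
  have cont: "continuous_on A (sol b j \<gamma>)" for A j
    by (meson DERIV_continuous_on DERIV_subset sol_deriv top_greatest)
  have zero: "sol b 1 \<gamma> t = 0" if t: "t \<in> {0<..<s}" for t
  proof -
    have "sol b 0 \<gamma> t = 0 \<and> sol b 1 \<gamma> t = 0"
    proof (rule linear_system_unique[of t s "sol b 0 \<gamma>" "sol b 1 \<gamma>" "\<lambda>_. 1" "\<lambda>r. - (\<gamma> / 4) * (1 + b * r) / r"
          "1 + \<bar>\<gamma>\<bar> * (1 + b * s) / t"])
      fix r assume r: "t < r" "r < s"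
      then have r0: "r > 0" using t by auto
      show "(sol b 0 \<gamma> has_real_derivative 1 * sol b 1 \<gamma> r) (at r)"
        using sol_deriv[of 0 \<gamma> r] by simp
      have "sol b 2 \<gamma> r = - (\<gamma> / 4) * (1 + b * r) / r * sol b 0 \<gamma> r"
        using sol_ode[of r \<gamma>] r0 by (simp add: field_simps)
      then show "(sol b 1 \<gamma> has_real_derivative - (\<gamma> / 4) * (1 + b * r) / r * sol b 0 \<gamma> r) (at r)"
        using sol_deriv[of 1 \<gamma> r] by (simp add: numeral_2_eq_2)
      have "\<bar>1 + - (\<gamma> / 4) * (1 + b * r) / r\<bar> \<le> 1 + \<bar>\<gamma> / 4\<bar> * (1 + b * r) / r"
        using r0 b abs_triangle_ineq[of 1 "- (\<gamma> / 4) * (1 + b * r) / r"] by (simp add: abs_mult)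
      also have "\<bar>\<gamma> / 4\<bar> * (1 + b * r) / r \<le> \<bar>\<gamma>\<bar> * (1 + b * s) / t"
        using r t b by (intro frac_le mult_mono mult_nonneg_nonneg) auto
      finally show "\<bar>1 + - (\<gamma> / 4) * (1 + b * r) / r\<bar> \<le> 1 + \<bar>\<gamma>\<bar> * (1 + b * s) / t" by simp
    qed (use z t cont in auto)
    then show ?thesis by simp
  qed
  have "sol b 1 \<gamma> 0 = 0"
    by (rule continuous_constant_on_closure[of "{0<..<s}"]) (use s zero cont in auto)
  then show False using sol_at_0 by simp
qed

lemma coef_continuous: "continuous_on A (\<lambda>\<gamma>. coef b \<gamma> n)"
proof (induction n rule: less_induct)
  case (less n)
  then show ?case
    by (cases "(b, 0::real, n)" rule: coef.cases) (auto intro!: continuous_intros)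
qed

lemma diffs_coef_continuous: "continuous_on A (\<lambda>\<gamma>. (diffs ^^ j) (coef b \<gamma>) n)"
  by (induction j arbitrary: n) (auto intro!: continuous_intros coef_continuous simp: diffs_def)

text \<open>The coefficient bounds are uniform for \<gamma> in [-G, G], so the Weierstrass test
  applies in both variables together.\<close>

lemma sol_continuous:
  "continuous_on ({-G..G} \<times> {0..1}) (\<lambda>(\<gamma>, s). sol b j \<gamma> s)"
proof (rule uniform_limit_theorem)
  let ?A = "{-G..G} \<times> {0..1::real}"
  show "uniform_limit ?A (\<lambda>n (\<gamma>, s). \<Sum>i<n. (diffs ^^ j) (coef b \<gamma>) i * s ^ i)
      (\<lambda>(\<gamma>, s). sol b j \<gamma> s) sequentially"
    unfolding sol_def case_prod_unfold
  proof (rule Weierstrass_m_test)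
    show "summable (\<lambda>n. (1 + G * (1 + b)) ^ (n + j) / fact n * 1 ^ n)"
      by (rule summable_majorant)
    fix n and z :: "real \<times> real" assume z: "z \<in> ?A"
    then have g: "\<bar>fst z\<bar> \<le> G" by auto
    have "norm ((diffs ^^ j) (coef b (fst z)) n * snd z ^ n)
        \<le> ((1 + G * (1 + b)) ^ (n + j) / fact n) * 1 ^ n"
      unfolding real_norm_def abs_mult power_abs
      by (intro mult_mono diffs_coef_bound[OF g] power_mono divide_nonneg_nonneg zero_le_power)
        (use z b in \<open>auto intro!: add_nonneg_nonneg mult_nonneg_nonneg\<close>)
    then show "norm ((diffs ^^ j) (coef b (fst z)) n * snd z ^ n)
        \<le> (1 + G * (1 + b)) ^ (n + j) / fact n * 1 ^ n" .
  qed
  show "\<forall>\<^sub>F n in sequentially. continuous_on ?A (\<lambda>(\<gamma>, s). \<Sum>i<n. (diffs ^^ j) (coef b \<gamma>) i * s ^ i)"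
    unfolding case_prod_unfold
    by (intro always_eventually allI continuous_intros
        continuous_on_compose2[OF diffs_coef_continuous]) auto
qed simp

end


section \<open>The spectra\<close>

text \<open>The invariant eigenvalues are the nonnegative zeros of this function.\<close>

definition bc_value :: "real \<Rightarrow> boundary_condition \<Rightarrow> real \<Rightarrow> real" where
  "bc_value b bc \<gamma> = (if bc = Dirichlet then sol b 1 \<gamma> 1 else \<gamma> * sol b 0 \<gamma> 1)"

context
  fixes b :: real
  assumes b: "b > 0"
begin

text \<open>If \<gamma> were at most 1 + b, then k^2 (1 + b r^2) - \<gamma> r^2 would be at least 1
  - r^2 > 0 for r < 1, and the energy identity would leave only the zero mode. The bound yields both
  the uniform gap and the divergence as b grows.\<close>

lemma noninvariant_spectrum_lower:
  assumes "\<gamma> \<in> noninvariant_spectrum bc (cigar b)"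
  shows "\<gamma> > 1 + b"
proof (rule ccontr)
  assume "\<not> \<gamma> > 1 + b"
  then have \<gamma>: "\<gamma> \<le> 1 + b" by simp
  obtain k u \<phi> where k: "k \<ge> 1" and u: "eigenfunction bc (cigar b) \<gamma> u"
    "\<And>r t. 0 \<le> r \<Longrightarrow> r \<le> 1 \<Longrightarrow> u (polar r t) = \<phi> r * cos (real k * t)"
    using assms unfolding noninvariant_spectrum_def mem_Collect_eq by (metis atLeastAtMost_iff)
  obtain p y where "radial_mode b bc k \<gamma> p y"
    using eigenfunction_radial_mode[OF b u] by blast
  note rm = this[unfolded radial_mode_def]
  obtain r where r: "r \<in> {0..1}" "p r \<noteq> 0" using rm by blast
  have "p r = 0"
  proof (rule positive_potential_imp_zero[of p y "\<lambda>r. (1 + b * r\<^sup>2) / r"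
        "\<lambda>r. (real k)\<^sup>2 * (1 + b * r\<^sup>2) / r - \<gamma> * r"])
    fix r :: real assume r: "0 < r" "r < 1"
    have D: "1 + b * r\<^sup>2 > 0" using b by (simp add: add_pos_nonneg)
    then show "0 < (1 + b * r\<^sup>2) / r" using r by simp
    have "(real k)\<^sup>2 \<ge> 1" using k by simp
    then have "(real k)\<^sup>2 * (1 + b * r\<^sup>2) \<ge> 1 + b * r\<^sup>2"
      using D by (metis less_imp_le mult_1 mult_right_mono)
    moreover have "\<gamma> * r\<^sup>2 \<le> (1 + b) * r\<^sup>2" using \<gamma> by (intro mult_right_mono) auto
    moreover have "r\<^sup>2 < 1" using r by (simp add: power_less_one_iff)
    ultimately have "(real k)\<^sup>2 * (1 + b * r\<^sup>2) - \<gamma> * r\<^sup>2 > 0" by (simp add: algebra_simps)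
    then have "((real k)\<^sup>2 * (1 + b * r\<^sup>2) - \<gamma> * r\<^sup>2) / r > 0" using r by simp
    then show "0 < (real k)\<^sup>2 * (1 + b * r\<^sup>2) / r - \<gamma> * r"
      using r by (simp add: diff_divide_distrib power2_eq_square)
  qed (use rm r in \<open>auto split: if_splits\<close>)
  with r show False by simp
qed

section \<open>The invariant spectrum as the zero set of a boundary function\<close>

lemma invariant_spectrum_radial_mode:
  assumes "\<gamma> \<in> invariant_spectrum bc (cigar b)"
  obtains p y where "radial_mode b bc 0 \<gamma> p y"
proof -
  obtain u where u: "eigenfunction bc (cigar b) \<gamma> u" "S1_invariant_function u"
    using assms by (auto simp: invariant_spectrum_def)
  have "u (polar r t) = u (polar r 0) * cos (real 0 * t)" if "0 \<le> r" "r \<le> 1" for r t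
  proof -
    have "u (rotation t *v polar r 0) = u (polar r 0)"
      using u(2) that norm_polar[of r 0] unfolding S1_invariant_function_def by simp
    then show ?thesis by (simp add: rotation_polar)
  qed
  from eigenfunction_radial_mode[OF b u(1) this] that show ?thesis by blast
qed

lemma invariant_spectrum_nonneg:
  assumes "\<gamma> \<in> invariant_spectrum bc (cigar b)"
  shows "\<gamma> \<ge> 0"
proof (rule ccontr)
  assume \<gamma>: "\<not> \<gamma> \<ge> 0"
  obtain p y where "radial_mode b bc 0 \<gamma> p y"
    using assms by (rule invariant_spectrum_radial_mode)
  note rm = this[unfolded radial_mode_def]
  obtain r where r: "r \<in> {0..1}" "p r \<noteq> 0" using rm by blast
  have "p r = 0"
  proof (rule positive_potential_imp_zero[of p y "\<lambda>r. (1 + b * r\<^sup>2) / r" "\<lambda>r. - \<gamma> * r"])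
    fix r :: real assume r: "0 < r" "r < 1"
    have "1 + b * r\<^sup>2 > 0" using b by (simp add: add_pos_nonneg)
    then show "0 < (1 + b * r\<^sup>2) / r" using r by simp
    show "0 < - \<gamma> * r" using r \<gamma> by (simp add: mult_neg_pos)
  qed (use rm r in \<open>auto split: if_splits\<close>)
  with r show False by simp
qed

lemma sol_cont: "continuous_on A (sol b j \<gamma>)"
  by (meson DERIV_continuous_on DERIV_subset sol_deriv[OF b] top_greatest)

text \<open>The Wronskian of a radial eigenfunction and \<open>sol b 1 \<gamma>\<close> vanishes at the origin, hence
  everywhere.\<close>

lemma invariant_spectrum_imp_bc_value:
  assumes "\<gamma> \<in> invariant_spectrum bc (cigar b)"
  shows "bc_value b bc \<gamma> = 0"
proof -
  obtain p y where "radial_mode b bc 0 \<gamma> p y"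
    using assms by (rule invariant_spectrum_radial_mode)
  note rm = this[unfolded radial_mode_def]
  have p': "(p has_real_derivative (1 + b * r\<^sup>2) / r * y r) (at r)"
    and y': "(y has_real_derivative - \<gamma> * r * p r) (at r)" if "0 < r" "r < 1" for r
    using rm that by auto
  define w where "w r = sol b 1 \<gamma> (r\<^sup>2)" for r
  \<comment> \<open>By the differential equation this is the flux
    \<open>r / (1 + b * r\<^sup>2)\<close> times w', written so that nothing is singular at the
    origin.\<close>
  define \<eta> where "\<eta> r = - (\<gamma> / 2) * sol b 0 \<gamma> (r\<^sup>2)" for r
  have sq: "((\<lambda>r. r\<^sup>2) has_real_derivative 2 * r) (at r)" for r :: real
    by (auto intro!: derivative_eq_intros)
  have w': "(w has_real_derivative (1 + b * r\<^sup>2) / r * \<eta> r) (at r)" if "0 < r" for r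
  proof (rule DERIV_cong)
    show "(w has_real_derivative sol b 2 \<gamma> (r\<^sup>2) * (2 * r)) (at r)"
      using sol_deriv_chain[OF b sq, of 1 \<gamma> r] by (simp add: w_def[abs_def] numeral_2_eq_2)
    have "r * (sol b 2 \<gamma> (r\<^sup>2) * (2 * r)) = (1 + b * r\<^sup>2) * \<eta> r"
      using sol_ode[OF b, of "r\<^sup>2" \<gamma>] unfolding \<eta>_def by (simp add: power2_eq_square field_simps)
    then show "sol b 2 \<gamma> (r\<^sup>2) * (2 * r) = (1 + b * r\<^sup>2) / r * \<eta> r"
      using that by (simp add: field_simps)
  qed
  have \<eta>': "(\<eta> has_real_derivative - \<gamma> * r * w r) (at r)" for r
    using DERIV_cmult[OF sol_deriv_chain[OF b sq, of 0 \<gamma> r], of "- (\<gamma> / 2)"]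
    by (simp add: w_def \<eta>_def[abs_def] mult_ac)
  define W where "W r = p r * \<eta> r - y r * w r" for r
  have "W 1 = W 0"
  proof (rule DERIV_isconst_end[of 0 1 W])
    have "continuous_on {0..1} w" "continuous_on {0..1} \<eta>"
      unfolding w_def[abs_def] \<eta>_def[abs_def]
      by (intro continuous_intros continuous_on_compose2[OF sol_cont[of UNIV]]; simp)+
    then show "continuous_on {0..1} W"
      unfolding W_def[abs_def] using rm by (intro continuous_intros) auto
    show "(W has_real_derivative 0) (at r)" if "0 < r" "r < 1" for r
      unfolding W_def[abs_def]
      by (rule p'[OF that] y'[OF that] w'[OF that(1)] \<eta>' derivative_eq_intros refl)+
        (simp add: algebra_simps)
  qed simp
  then have W: "p 1 * \<eta> 1 = y 1 * w 1"
    using rm sol_at_0[OF b] by (simp add: W_def \<eta>_def)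
  \<comment> \<open>Backward uniqueness from r = 1: the end values of a nonzero mode cannot both
    vanish. The one left nonzero by the boundary condition can therefore be cancelled in
    \<open>W\<close>.\<close>
  have "p 1 \<noteq> 0 \<or> y 1 \<noteq> 0"
  proof (rule ccontr)
    assume z: "\<not> (p 1 \<noteq> 0 \<or> y 1 \<noteq> 0)"
    have zero: "p a = 0" if a: "a \<in> {0<..<1}" for a
    proof -
      have "p a = 0 \<and> y a = 0"
      proof (rule linear_system_unique[of a 1 p y "\<lambda>r. (1 + b * r\<^sup>2) / r" "\<lambda>r. - \<gamma> * r"
            "(1 + b) / a + \<bar>\<gamma>\<bar>" a])
        fix r assume r: "a < r" "r < 1"
        then have r0: "0 < r" using a by auto
        have r2: "r\<^sup>2 \<le> 1" using r r0 by (simp add: power_le_one)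
        have "(1 + b * r\<^sup>2) / r \<le> (1 + b) / a"
          using r a b r2 by (intro frac_le) (auto intro: add_nonneg_nonneg)
        moreover have "(1 + b * r\<^sup>2) / r \<ge> 0" using r0 b by simp
        moreover have "\<bar>- \<gamma> * r\<bar> \<le> \<bar>\<gamma>\<bar>" using r r0 by (simp add: abs_mult mult_left_le)
        ultimately show "\<bar>(1 + b * r\<^sup>2) / r + - \<gamma> * r\<bar> \<le> (1 + b) / a + \<bar>\<gamma>\<bar>" by linarith
      qed (use z a rm p' y' in \<open>auto intro: continuous_on_subset\<close>)
      then show ?thesis by simp
    qed
    have "p r = 0" if "r \<in> {0..1}" for r
      by (rule continuous_constant_on_closure[of "{0<..<1}" p 0]) (use rm zero that in auto)
    with rm show False by blast
  qed
  with W rm show ?thesis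
    by (cases bc) (auto simp: bc_value_def w_def \<eta>_def)
qed

text \<open>The eigenfunction is v' evaluated at x1^2 + x2^2. It is smooth at the origin because v'
  is entire in s and s is a polynomial in the coordinates.\<close>

lemma bc_value_imp_invariant_spectrum:
  assumes "bc_value b bc \<gamma> = 0"
  shows "\<gamma> \<in> invariant_spectrum bc (cigar b)"
proof -
  define S where "S x = x $ 1 * x $ 1 + x $ 2 * x $ 2" for x :: plane
  define u where "u x = sol b 1 \<gamma> (S x)" for x
  have S_polar: "S (polar r t) = r\<^sup>2" for r t
    unfolding S_def polar_nth using sin_cos_squared_add[of t] by algebra
  have S1: "has_grad S (2 * x $ 1) (2 * x $ 2) x" for x
    unfolding S_def[abs_def] by (rule has_grad_eq, (rule has_grad_intros)+) simp_all
  have F: "has_grad (\<lambda>x. sol b j \<gamma> (S x)) (sol b (Suc j) \<gamma> (S x) * (2 * x $ 1))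
      (sol b (Suc j) \<gamma> (S x) * (2 * x $ 2)) x" for j x
    by (rule has_grad_chain[OF S1 sol_deriv[OF b]])
  have u1: "partial 1 u = (\<lambda>x. sol b 2 \<gamma> (S x) * (2 * x $ 1))"
    and u2: "partial 2 u = (\<lambda>x. sol b 2 \<gamma> (S x) * (2 * x $ 2))"
    using has_grad_partial[OF F[of 1]] by (auto simp: u_def[abs_def] numeral_2_eq_2)
  have "smooth_on_disc u"
    unfolding smooth_on_disc_def
  proof (intro exI[of _ UNIV] conjI allI)
    have "Ck_on k S UNIV" for k
      unfolding S_def[abs_def] by (intro Ck_on_add Ck_on_mult Ck_on_coord open_UNIV)
    then show "Ck_on k u UNIV" for k
      unfolding u_def[abs_def] by (intro Ck_on_chain[where F = "\<lambda>j. sol b j \<gamma>"] sol_deriv[OF b]) auto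
  qed simp_all
  moreover have "\<exists>x\<in>cball 0 1. u x \<noteq> 0"
    using sol_at_0[OF b] by (intro bexI[of _ 0]) (auto simp: u_def S_def)
  moreover have "laplace_beltrami (cigar b) u x + \<gamma> * u x = 0" for x
  proof -
    \<comment> \<open>Replacing \<gamma> / 4 by a variable makes all the relations polynomial, as
      \<open>algebra\<close> requires.\<close>
    define e where "e = \<gamma> / 4"
    have e: "\<gamma> = 4 * e" by (simp add: e_def)
    have g: "has_grad (partial 1 u) (2 * sol b 2 \<gamma> (S x) + sol b 3 \<gamma> (S x) * (4 * x $ 1 * x $ 1))
        (sol b 3 \<gamma> (S x) * (4 * x $ 1 * x $ 2)) x"
      "has_grad (partial 2 u) (sol b 3 \<gamma> (S x) * (4 * x $ 1 * x $ 2))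
        (2 * sol b 2 \<gamma> (S x) + sol b 3 \<gamma> (S x) * (4 * x $ 2 * x $ 2)) x"
      unfolding u1 u2 by (rule has_grad_eq, (rule has_grad_intros F)+; simp add: eval_nat_numeral)+
    show ?thesis
      using sol_ode[OF b, of "S x" \<gamma>, folded e_def] sol_ode_deriv[OF b, of \<gamma> "S x", folded e_def]
        sig_eq[OF b, of x] S_def[of x] e
      unfolding laplace_cigar[OF b g]
        has_grad_cigar[OF b, THEN has_grad_partial(1)] has_grad_cigar[OF b, THEN has_grad_partial(2)]
      unfolding u1 u2 cigar_def vector_2 u_def
      by algebra
  qed
  moreover have "satisfies_bc bc (cigar b) u"
  proof (cases bc)
    case Dirichlet
    have "u x = 0" if "x \<in> sphere 0 1" for x
    proof -
      obtain t where "x = polar (norm x) t" by (rule plane_eq_polar)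
      then have "S x = 1" using S_polar[of 1 t] that by simp
      then show ?thesis using Dirichlet assms by (simp add: u_def bc_value_def)
    qed
    with Dirichlet show ?thesis by simp
  next
    case Neumann
    have "conormal_derivative (cigar b) u x = 0" if "x \<in> sphere 0 1" for x
    proof -
      obtain t where "x = polar (norm x) t" by (rule plane_eq_polar)
      then have S: "S x = 1" using S_polar[of 1 t] that by simp
      \<comment> \<open>At s = 1 the differential equation turns the Neumann condition \<gamma> v =
        0 into v'' = 0, and both partial derivatives of \<open>u\<close> carry the factor
        v''.\<close>
      have "sol b 2 \<gamma> 1 = 0"
        using sol_ode[OF b, of 1 \<gamma>] assms Neumann by (auto simp: bc_value_def)
      with S have "partial 1 u x = 0" "partial 2 u x = 0" by (simp_all add: u1 u2)
      then show ?thesis by (simp add: conormal_derivative_def sum_2)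
    qed
    with Neumann show ?thesis by simp
  qed
  moreover have "S1_invariant_function u"
    unfolding S1_invariant_function_def
  proof (intro allI ballI)
    fix t x
    obtain s where "x = polar (norm x) s" by (rule plane_eq_polar)
    then show "u (rotation t *v x) = u x"
      by (metis S_polar rotation_polar u_def)
  qed
  ultimately show ?thesis
    by (auto simp: invariant_spectrum_def eigenfunction_def)
qed

text \<open>Lagrange's identity: \<open>W\<close> has derivative (\<gamma> - \<gamma>') / 4 times
  the product of the two eigenfunctions. It vanishes at 0 since v does, and at 1 by the common
  boundary condition.\<close>

lemma sol_orthogonal:
  assumes "bc_value b bc \<gamma> = 0" "bc_value b bc \<gamma>' = 0" "\<gamma> \<noteq> \<gamma>'"
  shows "integral {0..1} (\<lambda>s. sol b 1 \<gamma> s * sol b 1 \<gamma>' s) = 0"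
proof -
  define W where "W s = \<gamma> / 4 * sol b 1 \<gamma>' s * sol b 0 \<gamma> s - \<gamma>' / 4 * sol b 1 \<gamma> s * sol b 0 \<gamma>' s" for s
  have "(W has_real_derivative (\<gamma> - \<gamma>') / 4 * (sol b 1 \<gamma> s * sol b 1 \<gamma>' s)) (at s)"
    if "s \<in> {0..1}" for s
  proof (rule DERIV_cong)
    show "(W has_real_derivative \<gamma> / 4 * (sol b 2 \<gamma>' s * sol b 0 \<gamma> s + sol b 1 \<gamma>' s * sol b 1 \<gamma> s)
        - \<gamma>' / 4 * (sol b 2 \<gamma> s * sol b 0 \<gamma>' s + sol b 1 \<gamma> s * sol b 1 \<gamma>' s)) (at s)"
      unfolding W_def[abs_def]
      by (rule derivative_eq_intros sol_deriv_chain[OF b] refl)+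
        (simp add: numeral_2_eq_2 algebra_simps)
    \<comment> \<open>At s = 0 the equation says nothing about v'', but there both solutions vanish;
      elsewhere the equations cancel after multiplication by s.\<close>
    have "\<gamma> / 4 * sol b 2 \<gamma>' s * sol b 0 \<gamma> s - \<gamma>' / 4 * sol b 2 \<gamma> s * sol b 0 \<gamma>' s = 0"
    proof (cases "s = 0")
      case True
      then show ?thesis by (simp add: sol_at_0[OF b])
    next
      case False
      define e e' where "e = \<gamma> / 4" and "e' = \<gamma>' / 4"
      have "s * (e * sol b 2 \<gamma>' s * sol b 0 \<gamma> s - e' * sol b 2 \<gamma> s * sol b 0 \<gamma>' s) = 0"
        using sol_ode[OF b, of s \<gamma>, folded e_def] sol_ode[OF b, of s \<gamma>', folded e'_def] by algebra
      then have "s * (\<gamma> / 4 * sol b 2 \<gamma>' s * sol b 0 \<gamma> s - \<gamma>' / 4 * sol b 2 \<gamma> s * sol b 0 \<gamma>' s) = 0"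
        by (simp add: e_def e'_def)
      with False show ?thesis by simp
    qed
    then show "\<gamma> / 4 * (sol b 2 \<gamma>' s * sol b 0 \<gamma> s + sol b 1 \<gamma>' s * sol b 1 \<gamma> s)
        - \<gamma>' / 4 * (sol b 2 \<gamma> s * sol b 0 \<gamma>' s + sol b 1 \<gamma> s * sol b 1 \<gamma>' s)
        = (\<gamma> - \<gamma>') / 4 * (sol b 1 \<gamma> s * sol b 1 \<gamma>' s)"
      by (simp add: algebra_simps diff_divide_distrib)
  qed
  then have "((\<lambda>s. (\<gamma> - \<gamma>') / 4 * (sol b 1 \<gamma> s * sol b 1 \<gamma>' s)) has_integral W 1 - W 0) {0..1}"
    by (intro fundamental_theorem_of_calculus)
      (auto simp: has_real_derivative_iff_has_vector_derivative[symmetric] intro: DERIV_subset)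
  moreover have "W 0 = 0" by (simp add: W_def sol_at_0[OF b])
  moreover have "W 1 = 0"
    using assms(1,2) by (cases bc) (auto simp: W_def bc_value_def)
  ultimately have "((\<lambda>s. (\<gamma> - \<gamma>') / 4 * (sol b 1 \<gamma> s * sol b 1 \<gamma>' s)) has_integral 0) {0..1}"
    by simp
  from integral_unique[OF this]
  have "(\<gamma> - \<gamma>') / 4 * integral {0..1} (\<lambda>s. sol b 1 \<gamma> s * sol b 1 \<gamma>' s) = 0"
    unfolding integral_mult_right .
  then show ?thesis
    using assms(3) by simp
qed

lemma sol_continuous_compose:
  assumes "continuous_on A f" "continuous_on A g"
    and "\<And>x. x \<in> A \<Longrightarrow> \<bar>f x\<bar> \<le> G" "\<And>x. x \<in> A \<Longrightarrow> g x \<in> {0..1}"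
  shows "continuous_on A (\<lambda>x. sol b j (f x) (g x))"
proof -
  have "continuous_on A (\<lambda>x. (f x, g x))" using assms(1,2) by (intro continuous_intros)
  from continuous_on_compose2[OF sol_continuous[OF b, of G j] this] show ?thesis
    using assms(3,4) by (force simp: abs_le_iff)
qed

text \<open>At an accumulation point \<open>x\<close> of zeros, orthogonality and continuity would force
  \<open>sol b 1 x\<close> to have norm 0.\<close>

lemma finite_bc_zeros: "finite {\<gamma> \<in> {0..G}. bc_value b bc \<gamma> = 0}" (is "finite ?Z")
proof (rule ccontr)
  assume "infinite ?Z"
  then obtain x where x: "x \<in> {0..G}" "x islimpt ?Z"
    using Heine_Borel_imp_Bolzano_Weierstrass[of "{0..G}" ?Z] by (metis (lifting) compact_Icc mem_Collect_eq subsetI)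
  define h where "h z = integral {0..1} (\<lambda>s. sol b 1 (fst z) s * sol b 1 (snd z) s)" for z
  have conth: "continuous_on ({0..G} \<times> {0..G}) h"
  proof -
    have "continuous_on (({0..G} \<times> {0..G}) \<times> cbox 0 1)
        (\<lambda>(z, s). sol b 1 (fst z) s * sol b 1 (snd z) s)"
      unfolding case_prod_unfold
      by (intro continuous_on_mult sol_continuous_compose[where G = G] continuous_intros) auto
    from integral_continuous_on_param[OF this] show ?thesis by (simp add: h_def[abs_def])
  qed
  have c2: "continuous_on {0..1} (\<lambda>s. sol b 1 x s * sol b 1 x s)"
    by (intro continuous_intros sol_cont)
  \<comment> \<open>The integrand is continuous, nonnegative and equal to 1 at s = 0, whether or not
    \<open>x\<close> is itself a zero.\<close>
  have "h (x, x) \<noteq> 0"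
    using integral_eq_0_iff[OF c2] sol_at_0[OF b, of x] by (force simp: h_def)
  moreover have "h (x, x) \<ge> 0"
    using integral_nonneg[OF integrable_continuous_real[OF c2]] by (simp add: h_def)
  ultimately have hpos: "h (x, x) > 0" by simp
  obtain d where d: "d > 0" "\<And>z. z \<in> {0..G} \<times> {0..G} \<Longrightarrow> dist z (x, x) < d \<Longrightarrow> dist (h z) (h (x, x)) < h (x, x)"
    using conth[unfolded continuous_on_iff, rule_format, of "(x, x)" "h (x, x)"] x(1) hpos by auto
  obtain y where y: "y \<in> ?Z" "y \<noteq> x" "dist y x < d / 2"
    using x(2) d(1) unfolding islimpt_approachable by (meson half_gt_zero)
  \<comment> \<open>Taking \<open>z\<close> strictly closer to \<open>x\<close> than
    \<open>y\<close> makes the two zeros distinct, so that orthogonality applies to them.\<close>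
  obtain z where z: "z \<in> ?Z" "z \<noteq> x" "dist z x < min (d / 2) (dist y x)"
    using x(2) d(1) y(2) unfolding islimpt_approachable by (meson half_gt_zero min_less_iff_conj zero_less_dist_iff)
  have "dist (y, z) (x, x) \<le> dist y x + dist z x"
    unfolding dist_Pair_Pair by (rule sqrt_sum_squares_le_sum) auto
  then have "dist (h (y, z)) (h (x, x)) < h (x, x)"
    using y z by (intro d(2)) auto
  moreover have "h (y, z) = 0"
    using sol_orthogonal[of bc y z] y z by (auto simp: h_def)
  ultimately show False using hpos by (simp add: dist_real_def)
qed

end


section \<open>Counting the invariant eigenvalues\<close>

text \<open>This is (p q' - q p') / (p^2 + q^2) for p = v' and q = \<kappa> v, the rate of change of
  the polar angle. Integrating it gives a continuous angle without choosing branches of the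
  argument.\<close>

definition angle_speed :: "real \<Rightarrow> real \<Rightarrow> real \<Rightarrow> real \<Rightarrow> real" where
  "angle_speed b \<kappa> \<gamma> s = \<kappa> * ((sol b 1 \<gamma> s)\<^sup>2 - sol b 0 \<gamma> s * sol b 2 \<gamma> s) /
     ((sol b 1 \<gamma> s)\<^sup>2 + (\<kappa> * sol b 0 \<gamma> s)\<^sup>2)"

text \<open>The total increase over \<open>[0, 1]\<close> of the polar angle of the vector \<open>(v', \<kappa> v)\<close>, where
  \<open>v = sol b 0 \<gamma>\<close>.\<close>

definition angle :: "real \<Rightarrow> real \<Rightarrow> real \<Rightarrow> real" where
  "angle b \<kappa> \<gamma> = integral {0..1} (angle_speed b \<kappa> \<gamma>)"

context
  fixes b \<kappa> :: real
  assumes b: "b > 0" and \<kappa>: "\<kappa> > 0"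
begin

lemma angle_denom_pos:
  assumes "s \<ge> 0"
  shows "(sol b 1 \<gamma> s)\<^sup>2 + (\<kappa> * sol b 0 \<gamma> s)\<^sup>2 > 0"
proof -
  have "sol b 1 \<gamma> s \<noteq> 0 \<or> sol b 0 \<gamma> s \<noteq> 0"
    using sol_no_common_zero[OF b, of s \<gamma>] sol_at_0[OF b, of \<gamma>] assms by (cases "s = 0") auto
  with \<kappa> show ?thesis by (auto simp: sum_power2_gt_zero_iff)
qed

lemma angle_continuous: "continuous_on {0..G} (angle b \<kappa>)"
proof -
  have "(sol b 1 \<gamma> s)\<^sup>2 + (\<kappa> * sol b 0 \<gamma> s)\<^sup>2 \<noteq> 0" if "s \<ge> 0" for \<gamma> s
    using angle_denom_pos[OF that, of \<gamma>] by (metis order_less_irrefl)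
  then have "continuous_on ({0..G} \<times> cbox 0 1) (\<lambda>(\<gamma>, s). angle_speed b \<kappa> \<gamma> s)"
    unfolding case_prod_unfold angle_speed_def
    by (intro continuous_intros sol_continuous_compose[OF b, where G = G]) auto
  from integral_continuous_on_param[OF this] show ?thesis
    by (simp add: angle_def[abs_def])
qed

lemma angle_speed_continuous: "continuous_on {0..1} (angle_speed b \<kappa> \<gamma>)"
proof -
  have "(sol b 1 \<gamma> s)\<^sup>2 + (\<kappa> * sol b 0 \<gamma> s)\<^sup>2 \<noteq> 0" if "s \<in> {0..1}" for s
    using angle_denom_pos[of s \<gamma>] that by (metis atLeastAtMost_iff order_less_irrefl)
  then show ?thesis
    unfolding angle_speed_def[abs_def] by (intro continuous_intros sol_cont[OF b]) auto
qed

text \<open>The vector (v', \<kappa> v) at s = 1 is parallel to the direction given by the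
  integrated angle. \<open>Z\<close> is its component normal to that direction; both start along the
  first axis.\<close>

lemma angle_spec: "\<kappa> * sol b 0 \<gamma> 1 * cos (angle b \<kappa> \<gamma>) = sol b 1 \<gamma> 1 * sin (angle b \<kappa> \<gamma>)"
proof -
  define \<theta> where "\<theta> s = integral {0..s} (angle_speed b \<kappa> \<gamma>)" for s
  have \<theta>_within: "(\<theta> has_real_derivative angle_speed b \<kappa> \<gamma> s) (at s within {0..1})" if "s \<in> {0..1}" for s
    unfolding \<theta>_def[abs_def] by (rule integral_has_real_derivative[OF angle_speed_continuous that])
  then have \<theta>': "(\<theta> has_real_derivative angle_speed b \<kappa> \<gamma> s) (at s)" if "0 < s" "s < 1" for s
  proof -
    have "at s within {0..1} = at s" using that by (intro at_within_interior) simp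
    then show ?thesis using \<theta>_within[of s] that by simp
  qed
  have \<theta>_cont: "continuous_on {0..1} \<theta>"
    using \<theta>_within by (rule DERIV_continuous_on)
  define p where "p s = sol b 1 \<gamma> s" for s
  define q where "q s = \<kappa> * sol b 0 \<gamma> s" for s
  define R where "R s = (p s)\<^sup>2 + (q s)\<^sup>2" for s
  define Z where "Z s = q s * cos (\<theta> s) - p s * sin (\<theta> s)" for s
  have R: "R s > 0" if "s \<ge> 0" for s
    using angle_denom_pos[OF that] by (simp add: R_def p_def q_def)
  \<comment> \<open>The quotient is the squared sine of the angle between the vector and the
    direction \<theta>, and it is constant because both turn at the same speed.\<close>
  have "(Z 1)\<^sup>2 / R 1 = (Z 0)\<^sup>2 / R 0"
  proof (rule DERIV_isconst_end[of 0 1 "\<lambda>s. (Z s)\<^sup>2 / R s"])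
    show "continuous_on {0..1} (\<lambda>s. (Z s)\<^sup>2 / R s)"
      using R unfolding Z_def R_def p_def q_def
      by (intro continuous_intros sol_cont[OF b] \<theta>_cont) (force simp: R_def p_def q_def)
    fix s :: real assume s: "0 < s" "s < 1"
    define p1 where "p1 = sol b 2 \<gamma> s"
    define q1 where "q1 = \<kappa> * sol b 1 \<gamma> s"
    define t1 where "t1 = angle_speed b \<kappa> \<gamma> s"
    have p': "(p has_real_derivative p1) (at s)"
      using sol_deriv[OF b, of 1 \<gamma> s] by (simp add: p_def[abs_def] p1_def numeral_2_eq_2)
    have q': "(q has_real_derivative q1) (at s)"
      using DERIV_cmult[OF sol_deriv[OF b, of 0 \<gamma> s], of \<kappa>] by (simp add: q_def[abs_def] q1_def)
    have "\<kappa> * ((sol b 1 \<gamma> s)\<^sup>2 - sol b 0 \<gamma> s * sol b 2 \<gamma> s) = p s * q1 - q s * p1"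
      by (simp add: p_def q_def p1_def q1_def power2_eq_square algebra_simps)
    then have "t1 = (p s * q1 - q s * p1) / R s"
      by (simp only: t1_def angle_speed_def R_def p_def q_def)
    then have t1: "R s * t1 = p s * q1 - q s * p1"
      using R[of s] s by simp
    have Z': "(Z has_real_derivative q1 * cos (\<theta> s) - q s * t1 * sin (\<theta> s) - p1 * sin (\<theta> s) - p s * t1 * cos (\<theta> s)) (at s)"
      unfolding Z_def[abs_def]
      by (rule p' q' \<theta>'[OF s] derivative_eq_intros refl)+ (simp add: t1_def algebra_simps)
    have R': "(R has_real_derivative 2 * p s * p1 + 2 * q s * q1) (at s)"
      unfolding R_def[abs_def] by (rule p' q' derivative_eq_intros refl)+ (simp add: algebra_simps)
    have "R s * (q1 * cos (\<theta> s) - q s * t1 * sin (\<theta> s) - p1 * sin (\<theta> s) - p s * t1 * cos (\<theta> s))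
        = (p s * p1 + q s * q1) * Z s"
      using t1 R_def[of s] unfolding Z_def by algebra
    then have zero: "2 * Z s * (q1 * cos (\<theta> s) - q s * t1 * sin (\<theta> s) - p1 * sin (\<theta> s) - p s * t1 * cos (\<theta> s)) * R s
        - (Z s)\<^sup>2 * (2 * p s * p1 + 2 * q s * q1) = 0"
      by algebra
    have "((\<lambda>s. (Z s)\<^sup>2 / R s) has_real_derivative
       (2 * Z s * (q1 * cos (\<theta> s) - q s * t1 * sin (\<theta> s) - p1 * sin (\<theta> s) - p s * t1 * cos (\<theta> s)) * R s
        - (Z s)\<^sup>2 * (2 * p s * p1 + 2 * q s * q1)) / (R s * R s)) (at s)"
      using R[of s] s by (auto intro!: derivative_eq_intros Z' R')
    then show "((\<lambda>s. (Z s)\<^sup>2 / R s) has_real_derivative 0) (at s)"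
      unfolding zero by simp
  qed simp
  moreover have "Z 0 = 0"
    by (simp add: Z_def q_def \<theta>_def sol_at_0[OF b])
  ultimately have "Z 1 = 0" using R[of 1] by simp
  then show ?thesis by (simp add: Z_def \<theta>_def angle_def p_def q_def)
qed

lemma angle_imp_bc_value:
  fixes n :: nat
  assumes "angle b \<kappa> \<gamma> = (if bc = Dirichlet then real n * pi + pi / 2 else real n * pi)"
  shows "bc_value b bc \<gamma> = 0"
proof (cases bc)
  case Dirichlet
  with assms have a: "angle b \<kappa> \<gamma> = real n * pi + pi / 2" by simp
  have "sin (angle b \<kappa> \<gamma>) \<noteq> 0" "cos (angle b \<kappa> \<gamma>) = 0"
    unfolding a by (simp_all add: sin_add cos_add)
  then show ?thesis using angle_spec[of \<gamma>] Dirichlet by (simp add: bc_value_def)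
next
  case Neumann
  with assms have a: "angle b \<kappa> \<gamma> = real n * pi" by simp
  have "sin (angle b \<kappa> \<gamma>) = 0" "cos (angle b \<kappa> \<gamma>) \<noteq> 0"
    unfolding a by simp_all
  then show ?thesis using angle_spec[of \<gamma>] \<kappa> Neumann by (simp add: bc_value_def)
qed

text \<open>For \<gamma> = 0 the series reduces to v = s, so the vector is (1, \<kappa> s) and the
  angle is arctan \<kappa>.\<close>

lemma angle_at_0: "angle b \<kappa> 0 < pi / 2"
proof -
  have 0: "sol b 0 0 s = s" for s
  proof -
    have "coef b 0 n * s ^ n = (if n = 1 then s else 0)" for n
      by (cases "(b, 0::real, n)" rule: coef.cases) auto
    then show ?thesis using sums_unique[OF sums_single[of 1 "\<lambda>_. s"]] by (simp add: sol_def)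
  qed
  have 1: "sol b 1 0 s = 1" for s
    using DERIV_unique[OF sol_deriv[OF b, of 0 0 s], of 1] 0 by (simp add: 0[abs_def])
  have 2: "sol b 2 0 s = 0" for s
  proof -
    have "sol b 1 0 = (\<lambda>_. 1)" using 1 by auto
    from DERIV_unique[OF sol_deriv[OF b, of 1 0 s, unfolded this] DERIV_const] show ?thesis
      by (simp add: numeral_2_eq_2)
  qed
  have "((\<lambda>s. arctan (\<kappa> * s)) has_real_derivative angle_speed b \<kappa> 0 s) (at s)" for s
    unfolding angle_speed_def 0 1 2
    by (auto intro!: derivative_eq_intros simp: divide_inverse)
  then have "(angle_speed b \<kappa> 0 has_integral arctan (\<kappa> * 1) - arctan (\<kappa> * 0)) {0..1}"
    by (intro fundamental_theorem_of_calculus)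
      (auto simp: has_real_derivative_iff_has_vector_derivative[symmetric] intro: DERIV_subset)
  then have "angle b \<kappa> 0 = arctan \<kappa>"
    by (simp add: angle_def integral_unique)
  then show ?thesis using arctan_ubound by simp
qed

text \<open>For s > 0, v'' = -q v with q = (\<gamma> / 4) (1 + b s) / s at least \<gamma> b / 4 =
  \<kappa>^2. So -v v'' is at least (\<kappa> v)^2, and the angular speed is at least \<kappa>
  throughout.\<close>

lemma angle_ge:
  assumes "\<gamma> * b = 4 * \<kappa>\<^sup>2"
  shows "angle b \<kappa> \<gamma> \<ge> \<kappa>"
proof -
  have "angle_speed b \<kappa> \<gamma> s \<ge> \<kappa>" if s: "s \<in> {0..1}" for s
  proof -
    have "- (sol b 0 \<gamma> s * sol b 2 \<gamma> s) \<ge> (\<kappa> * sol b 0 \<gamma> s)\<^sup>2"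
    proof (cases "s = 0")
      case True
      then show ?thesis by (simp add: sol_at_0[OF b])
    next
      case False
      with s have s0: "s > 0" by auto
      have "\<gamma> \<ge> 0" using assms b by (metis mult_less_0_iff not_less zero_le_mult_iff zero_le_numeral zero_le_power2)
      have "s * (- (sol b 0 \<gamma> s * sol b 2 \<gamma> s)) = \<gamma> / 4 * (1 + b * s) * (sol b 0 \<gamma> s)\<^sup>2"
        using arg_cong[OF sol_ode[OF b, of s \<gamma>], of "\<lambda>x. x * sol b 0 \<gamma> s"]
        by (simp add: power2_eq_square field_simps)
      moreover have "\<dots> \<ge> \<gamma> / 4 * (b * s) * (sol b 0 \<gamma> s)\<^sup>2"
        using \<open>\<gamma> \<ge> 0\<close> by (intro mult_right_mono mult_left_mono) auto
      moreover have "\<gamma> / 4 * (b * s) * (sol b 0 \<gamma> s)\<^sup>2 = s * (\<kappa> * sol b 0 \<gamma> s)\<^sup>2"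
      proof -
        have "\<gamma> / 4 * (b * s) = s * \<kappa>\<^sup>2" using assms by simp
        then show ?thesis by (simp only: power_mult_distrib mult.assoc)
      qed
      ultimately have "s * (\<kappa> * sol b 0 \<gamma> s)\<^sup>2 \<le> s * (- (sol b 0 \<gamma> s * sol b 2 \<gamma> s))" by linarith
      then show ?thesis using s0 by (simp only: mult_le_cancel_left_pos)
    qed
    then have "\<kappa> * ((sol b 1 \<gamma> s)\<^sup>2 + (\<kappa> * sol b 0 \<gamma> s)\<^sup>2)
        \<le> \<kappa> * ((sol b 1 \<gamma> s)\<^sup>2 - sol b 0 \<gamma> s * sol b 2 \<gamma> s)"
      using \<kappa> by (intro mult_left_mono) auto
    then show ?thesis
      using angle_denom_pos[of s \<gamma>] s by (simp add: angle_speed_def pos_le_divide_eq)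
  qed
  then have "integral {0..1::real} (\<lambda>_. \<kappa>) \<le> integral {0..1} (angle_speed b \<kappa> \<gamma>)"
    by (intro integral_le integrable_continuous_real angle_speed_continuous continuous_intros) auto
  then show ?thesis by (simp add: angle_def)
qed

text \<open>The angle passes each of \<open>m\<close> prescribed values by the intermediate value
  theorem, and distinct values need distinct \<gamma>. Finiteness of the zero set matters here
  because \<open>card\<close> of an infinite set is 0.\<close>

lemma card_bc_zeros:
  assumes G: "G * b = 4 * \<kappa>\<^sup>2" and m: "real m * pi \<le> \<kappa>"
  shows "m \<le> card {\<gamma> \<in> {0..G}. bc_value b bc \<gamma> = 0}"
proof -
  \<comment> \<open>The Neumann values start at pi rather than 0, since every target must lie above
    the angle at \<gamma> = 0, which is only bounded by pi / 2. The last target is at most m pi in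
    both cases.\<close>
  define target where "target n = (if bc = Dirichlet then real n * pi + pi / 2 else real (Suc n) * pi)" for n
  have "G * b \<ge> 0" using G by simp
  then have "G \<ge> 0" using b by (simp add: zero_le_mult_iff)
  have "\<exists>\<gamma>. \<gamma> \<in> {0..G} \<and> angle b \<kappa> \<gamma> = target n" if "n < m" for n
  proof -
    have "real (Suc n) * pi \<le> real m * pi"
      using that by (intro mult_right_mono) auto
    then have "real n * pi + pi \<le> real m * pi"
      by (simp add: distrib_right)
    moreover from this have "real n * pi + pi / 2 \<le> real m * pi"
      using pi_gt_zero by linarith
    ultimately have "target n \<le> angle b \<kappa> G"
      using m angle_ge[OF G] by (simp add: target_def distrib_right)
    moreover have "angle b \<kappa> 0 \<le> target n"
    proof -
      have "real n * pi \<ge> 0" by simp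
      then have "angle b \<kappa> 0 \<le> real n * pi + pi / 2" "angle b \<kappa> 0 \<le> real n * pi + pi"
        using angle_at_0 pi_gt_zero by linarith+
      then show ?thesis by (simp add: target_def distrib_right add.commute)
    qed
    ultimately show ?thesis
      using IVT'[of "angle b \<kappa>" 0 "target n" G] \<open>G \<ge> 0\<close> angle_continuous by auto
  qed
  then obtain \<gamma> where \<gamma>: "\<And>n. n < m \<Longrightarrow> \<gamma> n \<in> {0..G} \<and> angle b \<kappa> (\<gamma> n) = target n"
    by metis
  have "inj_on \<gamma> {..<m}"
  proof (rule inj_onI)
    fix i j assume "i \<in> {..<m}" "j \<in> {..<m}" "\<gamma> i = \<gamma> j"
    then have "target i = target j" using \<gamma> by (metis lessThan_iff)
    then show "i = j" by (auto simp: target_def split: if_splits)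
  qed
  moreover have "\<gamma> ` {..<m} \<subseteq> {\<gamma> \<in> {0..G}. bc_value b bc \<gamma> = 0}"
  proof (rule image_subsetI)
    fix n assume "n \<in> {..<m}"
    then have "\<gamma> n \<in> {0..G}" "angle b \<kappa> (\<gamma> n) = target n" using \<gamma> by auto
    then show "\<gamma> n \<in> {\<gamma> \<in> {0..G}. bc_value b bc \<gamma> = 0}"
      using angle_imp_bc_value[of "\<gamma> n" bc n] angle_imp_bc_value[of "\<gamma> n" bc "Suc n"]
      by (auto simp: target_def split: if_splits)
  qed
  ultimately show ?thesis
    using card_inj_on_le[OF _ _ finite_bc_zeros[OF b]] by fastforce
qed

end

section \<open>From counting to the ordered listing, and the family of metrics\<close>

lemma nth_in_order_exists:
  fixes S :: "real set"
  assumes fin: "finite {y \<in> S. y < e}" and n: "n < card {y \<in> S. y < e}"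
  shows "\<exists>x<e. nth_in_order S n x"
proof -
  let ?T = "{y \<in> S. y < e}"
  define xs where "xs = sorted_list_of_set ?T"
  have xs: "set xs = ?T" "sorted xs" "distinct xs" "length xs = card ?T"
    using fin by (simp_all add: xs_def)
  then have sd: "sorted_wrt (<) xs" by (simp add: strict_sorted_iff)
  have n': "n < length xs" using n xs by simp
  have x: "xs ! n \<in> ?T" using n' xs(1) nth_mem by blast
  have less: "xs ! i < xs ! j \<longleftrightarrow> i < j" if "i < length xs" "j < length xs" for i j
    using sorted_wrt_nth_less[OF sd, of i j] sorted_wrt_nth_less[OF sd, of j i] that
    by (metis linorder_neqE_nat order_less_asym order_less_irrefl)
  have "{y \<in> S. y < xs ! n} = (!) xs ` {..<n}"
  proof (intro equalityI subsetI)
    fix y assume y: "y \<in> {y \<in> S. y < xs ! n}"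
    then have "y \<in> set xs" using x xs(1) by auto
    then obtain i where "i < length xs" "y = xs ! i" by (metis in_set_conv_nth)
    with y less[of i n] n' show "y \<in> (!) xs ` {..<n}" by auto
  next
    fix y assume "y \<in> (!) xs ` {..<n}"
    then obtain i where i: "i < n" "y = xs ! i" by auto
    then have "y \<in> set xs" "y < xs ! n" using n' less[of i n] by auto
    then show "y \<in> {y \<in> S. y < xs ! n}" using xs(1) by auto
  qed
  moreover have "card ((!) xs ` {..<n}) = n"
    using card_image[OF inj_on_nth[OF xs(3), of "{..<n}"]] n' by auto
  ultimately show ?thesis
    using x by (intro exI[of _ "xs ! n"]) (auto simp: nth_in_order_def)
qed

lemma small_invariant_eigenvalues:
  assumes "\<epsilon> > 0" "b > 8 * pi\<^sup>2 * (real m)\<^sup>2 / \<epsilon>" "n < m"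
  shows "\<exists>\<gamma><\<epsilon>. nth_in_order (invariant_spectrum bc (cigar b)) n \<gamma>"
proof (rule nth_in_order_exists)
  have "8 * pi\<^sup>2 * (real m)\<^sup>2 / \<epsilon> \<ge> 0" using assms(1) by simp
  with assms(2) have b: "b > 0" by linarith
  let ?S = "invariant_spectrum bc (cigar b)"
  have "{y \<in> ?S. y < \<epsilon>} \<subseteq> {\<gamma> \<in> {0..\<epsilon>}. bc_value b bc \<gamma> = 0}"
    using invariant_spectrum_imp_bc_value[OF b] invariant_spectrum_nonneg[OF b] by auto
  then show fin: "finite {y \<in> ?S. y < \<epsilon>}"
    using finite_bc_zeros[OF b] by (rule finite_subset)
  \<comment> \<open>This solves \<gamma> b = 4 \<kappa>^2 for \<gamma> = \<epsilon> / 2; the half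
    keeps the zeros found strictly below \<epsilon>. The hypothesis on \<open>b\<close> says exactly
    that \<kappa> exceeds m pi.\<close>
  define \<kappa> where "\<kappa> = sqrt (\<epsilon> / 2 * b / 4)"
  have \<kappa>: "\<kappa> > 0" "\<epsilon> / 2 * b = 4 * \<kappa>\<^sup>2" using assms(1) b by (simp_all add: \<kappa>_def)
  have "(real m * pi)\<^sup>2 \<le> \<epsilon> / 2 * b / 4"
    using assms(1,2) by (simp add: field_simps power_mult_distrib)
  then have "real m * pi \<le> \<kappa>"
    unfolding \<kappa>_def by (rule real_le_rsqrt)
  then have "m \<le> card {\<gamma> \<in> {0..\<epsilon> / 2}. bc_value b bc \<gamma> = 0}"
    by (rule card_bc_zeros[OF b \<kappa>])
  also have "\<dots> \<le> card {y \<in> ?S. y < \<epsilon>}"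
    using bc_value_imp_invariant_spectrum[OF b] assms(1) by (intro card_mono fin) auto
  finally show "n < card {y \<in> ?S. y < \<epsilon>}" using assms(3) by simp
qed

theorem theorem1:
  "\<exists>(I :: real set) (g :: real \<Rightarrow> metric) (J :: nat \<Rightarrow> real \<Rightarrow> real set).
     is_interval I \<and>
     (\<forall>\<delta>\<in>I. riemannian_metric (g \<delta>) \<and> S1_invariant_metric (g \<delta>) \<and>
        (\<forall>x\<in>cball 0 1. gauss_curvature (g \<delta>) x > 0) \<and> has_area (g \<delta>) pi) \<and>
     (\<forall>m\<ge>1. \<forall>\<epsilon>>0.
        J m \<epsilon> \<subseteq> I \<and> J m \<epsilon> \<noteq> {} \<and> open (J m \<epsilon>) \<and> is_interval (J m \<epsilon>) \<and>
        (\<forall>\<delta>\<in>J m \<epsilon>. \<forall>bc. \<forall>n<m. \<exists>\<gamma><\<epsilon>.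
           nth_in_order (invariant_spectrum bc (g \<delta>)) n \<gamma>)) \<and>
     (\<exists>c>0. \<forall>\<delta>\<in>I. \<forall>bc. \<forall>\<gamma>\<in>noninvariant_spectrum bc (g \<delta>). \<gamma> \<ge> c) \<and>
     (\<forall>m\<ge>1. \<forall>R>0. \<exists>\<epsilon>\<^sub>0>0. \<forall>\<epsilon>. 0 < \<epsilon> \<and> \<epsilon> < \<epsilon>\<^sub>0 \<longrightarrow>
        (\<forall>\<delta>\<in>J m \<epsilon>. \<forall>bc. \<forall>\<gamma>\<in>noninvariant_spectrum bc (g \<delta>). \<gamma> > R))"
proof -
  define K where "K m = 8 * pi\<^sup>2 * (real m)\<^sup>2" for m :: nat
  define J where "J m \<epsilon> = {K m / \<epsilon><..}" for m and \<epsilon> :: real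
  show ?thesis
  proof (intro exI[of _ "{0<..}"] exI[of _ cigar] exI[of _ J] conjI allI ballI impI)
    fix m :: nat and \<epsilon> :: real assume "1 \<le> m" "0 < \<epsilon>"
    then have "K m / \<epsilon> \<ge> 0" by (simp add: K_def)
    then show "J m \<epsilon> \<subseteq> {0<..}" by (auto simp: J_def)
    show "\<exists>\<gamma><\<epsilon>. nth_in_order (invariant_spectrum bc (cigar \<delta>)) n \<gamma>"
      if "\<delta> \<in> J m \<epsilon>" "n < m" for \<delta> bc n
      using small_invariant_eigenvalues[OF \<open>0 < \<epsilon>\<close> _ that(2)] that(1) by (simp add: J_def K_def)
  next
    show "\<exists>c>0. \<forall>\<delta>\<in>{0<..}. \<forall>bc. \<forall>\<gamma>\<in>noninvariant_spectrum bc (cigar \<delta>). \<gamma> \<ge> c"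
      using noninvariant_spectrum_lower by (intro exI[of _ 1]) force
  next
    fix m :: nat and R :: real assume m: "1 \<le> m" and R: "0 < R"
    then have K: "K m > 0" by (simp add: K_def)
    show "\<exists>\<epsilon>\<^sub>0>0. \<forall>\<epsilon>. 0 < \<epsilon> \<and> \<epsilon> < \<epsilon>\<^sub>0 \<longrightarrow>
        (\<forall>\<delta>\<in>J m \<epsilon>. \<forall>bc. \<forall>\<gamma>\<in>noninvariant_spectrum bc (cigar \<delta>). \<gamma> > R)"
    \<comment> \<open>If \<epsilon> < K m / R, then every \<delta> in \<open>J m \<epsilon>\<close>
      exceeds K m / \<epsilon> > R, while non-invariant eigenvalues exceed 1 + \<delta>.\<close>
    proof (intro exI[of _ "K m / R"] conjI allI impI ballI)
      fix \<epsilon> \<delta> bc \<gamma>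
      assume \<epsilon>: "0 < \<epsilon> \<and> \<epsilon> < K m / R" and \<delta>: "\<delta> \<in> J m \<epsilon>"
        and \<gamma>: "\<gamma> \<in> noninvariant_spectrum bc (cigar \<delta>)"
      have "R < K m / \<epsilon>" using \<epsilon> R by (simp add: field_simps)
      then have "R < \<delta>" using \<delta> by (simp add: J_def)
      then show "\<gamma> > R" using noninvariant_spectrum_lower[OF _ \<gamma>] R by simp
    qed (use K R in simp)
  qed (auto simp: J_def is_interval_1 riemannian_metric_cigar S1_invariant_metric_cigar
      gauss_curvature_cigar has_area_cigar sig_pos)
qed

end
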